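(* Let $\mathscr{R}$ be a finite von Neumann algebra with a faithful normal tracial state $\tau$, let $\mathscr{S}$ be a von Neumann subalgebra of $\mathscr{R}$, and let $\Phi:\mathscr{R}\to\mathscr{S}$ be a $\tau$-preserving conditional expectation from $\mathscr{R}$ onto $\mathscr{S}$. Let $\Delta$ denote the Fuglede-Kadison determinant on $\mathscr{R}$ associated with $\tau$. Let $f:(0,\infty)\to(0,\infty)$ be a non-constant operator monotone function. Then for a regular positive operator $A$ in $\mathscr{R}$, $$\Delta(f(A))\le\Delta(f(\Phi(A))),$$ with equality if and only if $\Phi(A)=A$, i.e. $A\in\mathscr{S}$.
   Context: Von Neumann algebras act on a separable complex Hilbert space and contain the identity operator $I$; $\mathscr{S}$ contains the identity $I$ of $\mathscr{R}$. "Regular" means invertible (with bounded inverse). Conditional expectation: a map $\Phi:\mathscr{R}\to\mathscr{S}$ that is linear, positive, with $\Phi(I)=I$, and $\Phi(S_1RS_2)=S_1\Phi(R)S_2$ for all $R\in\mathscr{R}$, $S_1,S_2\in\mathscr{S}$. It is $\tau$-preserving if $\tau(\Phi(R))=\tau(R)$ for all $R\in\mathscr{R}$. Fuglede-Kadison determinant: for regular $A\in\mathscr{R}$, $\Delta(A)=\exp(\tau(\log (A^*A)^{1/2}))$. A continuous real function $f$ on an interval $\Gamma\subseteq\mathbb{R}$ is operator monotone if for all self-adjoint operators $A\le B$ on an infinite-dimensional Hilbert space with spectra in $\Gamma$ one has $f(A)\le f(B)$. $f(A)$ is defined by the continuous functional calculus. *)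

theory Defs
  imports "HOL-Analysis.Analysis" "HOL-Computational_Algebra.Polynomial"
begin

section \<open>Complex Hilbert spaces\<close>

text \<open>
  The norm, the topology and completeness are those of the underlying real Hilbert space, whose
  inner product is the real part of \<open>cinner\<close>. The complex inner product is linear in its first
  argument.
\<close>

class complex_hilbert = real_inner + complete_space +
  fixes scaleC :: "complex \<Rightarrow> 'a \<Rightarrow> 'a" (infixr \<open>*\<^sub>C\<close> 75)
    and cinner :: "'a \<Rightarrow> 'a \<Rightarrow> complex"
  assumes scaleC_add_right: "c *\<^sub>C (x + y) = c *\<^sub>C x + c *\<^sub>C y"
    and scaleC_add_left: "(c + d) *\<^sub>C x = c *\<^sub>C x + d *\<^sub>C x"
    and scaleC_scaleC: "c *\<^sub>C (d *\<^sub>C x) = (c * d) *\<^sub>C x"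
    and scaleC_of_real: "complex_of_real r *\<^sub>C x = r *\<^sub>R x"
    and cinner_commute: "cinner x y = cnj (cinner y x)"
    and cinner_add_left: "cinner (x + y) z = cinner x z + cinner y z"
    and cinner_scaleC_left: "cinner (c *\<^sub>C x) y = c * cinner x y"
    and Re_cinner: "Re (cinner x y) = inner x y"

text \<open>Being finite-dimensional over the reals and over the complex numbers is the same.\<close>

definition infinite_dimensional :: "'k::complex_hilbert itself \<Rightarrow> bool" where
  "infinite_dimensional _ \<longleftrightarrow> (\<forall>B::'k set. finite B \<longrightarrow> span B \<noteq> UNIV)"

lemma norm_scaleC: "norm (c *\<^sub>C x) = cmod c * norm (x::'a::complex_hilbert)"
proof -
  have r: "cinner y (c *\<^sub>C x) = cnj c * cinner y x" for y :: 'a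
    by (metis cinner_commute cinner_scaleC_left complex_cnj_mult)
  have "inner (c *\<^sub>C x) (c *\<^sub>C x) = Re (c * cnj c * cinner x x)"
    by (metis Re_cinner r cinner_scaleC_left mult.assoc)
  also have "c * cnj c = complex_of_real ((cmod c)\<^sup>2)"
    by (simp only: complex_norm_square)
  finally have "(norm (c *\<^sub>C x))\<^sup>2 = (cmod c * norm x)\<^sup>2"
    by (simp add: power2_norm_eq_inner power_mult_distrib Re_cinner flip: of_real_power)
  then show ?thesis
    by (simp add: power2_eq_iff_nonneg)
qed

lemma bounded_linear_scaleC: "bounded_linear (\<lambda>x::'a::complex_hilbert. c *\<^sub>C x)"
proof (rule bounded_linear_intro)
  show "c *\<^sub>C (r *\<^sub>R x) = r *\<^sub>R (c *\<^sub>C x)" for r and x :: 'a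
    by (metis scaleC_of_real scaleC_scaleC mult.commute)
  show "norm (c *\<^sub>C x) \<le> norm x * cmod c" for x :: 'a
    by (simp add: norm_scaleC mult.commute)
qed (rule scaleC_add_right)


section \<open>Bounded operators\<close>

text \<open>
  The type of bounded operators of the library consists of the real-linear ones; the bounded
  operators on the complex Hilbert space are the elements of \<open>clinear_ops\<close>.
\<close>

definition clinear_ops :: "('h::complex_hilbert \<Rightarrow>\<^sub>L 'h) set" where
  "clinear_ops = {T :: 'h \<Rightarrow>\<^sub>L 'h. \<forall>c x. T (c *\<^sub>C x) = c *\<^sub>C T x}"

lift_definition scalar_op :: "complex \<Rightarrow> 'h::complex_hilbert \<Rightarrow>\<^sub>L 'h" is "\<lambda>c x. c *\<^sub>C x"
  by (rule bounded_linear_scaleC)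

definition cadjoint :: "('h::complex_hilbert \<Rightarrow>\<^sub>L 'h) \<Rightarrow> 'h \<Rightarrow>\<^sub>L 'h" where
  "cadjoint T = (THE S :: 'h \<Rightarrow>\<^sub>L 'h. \<forall>x y. cinner (T x) y = cinner x (S y))"

definition selfadjoint_op :: "('h::complex_hilbert \<Rightarrow>\<^sub>L 'h) \<Rightarrow> bool" where
  "selfadjoint_op A \<longleftrightarrow> A \<in> clinear_ops \<and> cadjoint A = A"

definition positive_op :: "('h::complex_hilbert \<Rightarrow>\<^sub>L 'h) \<Rightarrow> bool" where
  "positive_op A \<longleftrightarrow> A \<in> clinear_ops \<and> (\<forall>x. cinner (A x) x \<in> \<real>\<^sub>\<ge>\<^sub>0)"

definition op_le :: "('h::complex_hilbert \<Rightarrow>\<^sub>L 'h) \<Rightarrow> ('h \<Rightarrow>\<^sub>L 'h) \<Rightarrow> bool" (infix \<open>\<le>\<^sub>o\<^sub>p\<close> 50) where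
  "A \<le>\<^sub>o\<^sub>p B \<longleftrightarrow> positive_op (B - A)"

definition regular_op :: "('h::complex_hilbert \<Rightarrow>\<^sub>L 'h) \<Rightarrow> bool" where
  "regular_op A \<longleftrightarrow> A \<in> clinear_ops \<and>
     (\<exists>B\<in>clinear_ops. A o\<^sub>L B = id_blinfun \<and> B o\<^sub>L A = id_blinfun)"

definition spectrum_op :: "('h::complex_hilbert \<Rightarrow>\<^sub>L 'h) \<Rightarrow> complex set" where
  "spectrum_op A = {c. \<not> regular_op (A - scalar_op c)}"

definition projection_op :: "('h::complex_hilbert \<Rightarrow>\<^sub>L 'h) \<Rightarrow> bool" where
  "projection_op E \<longleftrightarrow> selfadjoint_op E \<and> E o\<^sub>L E = E"


section \<open>Continuous functional calculus\<close>

definition poly_op :: "real poly \<Rightarrow> ('h::complex_hilbert \<Rightarrow>\<^sub>L 'h) \<Rightarrow> 'h \<Rightarrow>\<^sub>L 'h" where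
  "poly_op p A = (\<Sum>i\<le>degree p. coeff p i *\<^sub>R (((o\<^sub>L) A ^^ i) id_blinfun))"

text \<open>
  For a self-adjoint operator \<open>A\<close> and a real function \<open>f\<close> continuous on the (real) spectrum of
  \<open>A\<close>, \<open>cfc f A\<close> is the norm limit of \<open>p\<^sub>n(A)\<close> for polynomials \<open>p\<^sub>n\<close> converging to \<open>f\<close> uniformly
  on the spectrum. The values of \<open>f\<close> off the spectrum are irrelevant.
\<close>

definition cfc :: "(real \<Rightarrow> real) \<Rightarrow> ('h::complex_hilbert \<Rightarrow>\<^sub>L 'h) \<Rightarrow> 'h \<Rightarrow>\<^sub>L 'h" where
  "cfc f A = (THE T. \<forall>p :: nat \<Rightarrow> real poly.
     uniform_limit {t. complex_of_real t \<in> spectrum_op A} (\<lambda>n. poly (p n)) f sequentially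
     \<longrightarrow> (\<lambda>n. poly_op (p n) A) \<longlonglongrightarrow> T)"

definition operator_monotone_on ::
    "'k::complex_hilbert itself \<Rightarrow> real set \<Rightarrow> (real \<Rightarrow> real) \<Rightarrow> bool" where
  "operator_monotone_on _ \<Gamma> f \<longleftrightarrow> is_interval \<Gamma> \<and> continuous_on \<Gamma> f \<and>
     (\<forall>A B :: 'k \<Rightarrow>\<^sub>L 'k. selfadjoint_op A \<and> selfadjoint_op B \<and>
        spectrum_op A \<subseteq> complex_of_real ` \<Gamma> \<and> spectrum_op B \<subseteq> complex_of_real ` \<Gamma> \<and>
        A \<le>\<^sub>o\<^sub>p B \<longrightarrow> cfc f A \<le>\<^sub>o\<^sub>p cfc f B)"


section \<open>Von Neumann algebras\<close>

definition von_neumann_algebra :: "('h::complex_hilbert \<Rightarrow>\<^sub>L 'h) set \<Rightarrow> bool" where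
  "von_neumann_algebra R \<longleftrightarrow> R \<subseteq> clinear_ops \<and> id_blinfun \<in> R \<and>
     (\<forall>A\<in>R. \<forall>B\<in>R. A + B \<in> R) \<and> (\<forall>c. \<forall>A\<in>R. scalar_op c o\<^sub>L A \<in> R) \<and>
     (\<forall>A\<in>R. \<forall>B\<in>R. A o\<^sub>L B \<in> R) \<and> (\<forall>A\<in>R. cadjoint A \<in> R) \<and>
     closedin strong_operator_topology R"

definition mvn_equivalent ::
    "('h::complex_hilbert \<Rightarrow>\<^sub>L 'h) set \<Rightarrow> ('h \<Rightarrow>\<^sub>L 'h) \<Rightarrow> ('h \<Rightarrow>\<^sub>L 'h) \<Rightarrow> bool" where
  "mvn_equivalent R E F \<longleftrightarrow> (\<exists>V\<in>R. cadjoint V o\<^sub>L V = E \<and> V o\<^sub>L cadjoint V = F)"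

definition finite_projection :: "('h::complex_hilbert \<Rightarrow>\<^sub>L 'h) set \<Rightarrow> ('h \<Rightarrow>\<^sub>L 'h) \<Rightarrow> bool" where
  "finite_projection R E \<longleftrightarrow> E \<in> R \<and> projection_op E \<and>
     (\<forall>F\<in>R. projection_op F \<and> F \<le>\<^sub>o\<^sub>p E \<and> mvn_equivalent R E F \<longrightarrow> F = E)"

definition finite_von_neumann_algebra :: "('h::complex_hilbert \<Rightarrow>\<^sub>L 'h) set \<Rightarrow> bool" where
  "finite_von_neumann_algebra R \<longleftrightarrow> von_neumann_algebra R \<and> finite_projection R id_blinfun"


section \<open>Faithful normal tracial states\<close>

text \<open>
  Functionals on and maps from an algebra \<open>R\<close> are total functions; only their values on \<open>R\<close>
  matter.
\<close>

definition state_on ::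
    "('h::complex_hilbert \<Rightarrow>\<^sub>L 'h) set \<Rightarrow> (('h \<Rightarrow>\<^sub>L 'h) \<Rightarrow> complex) \<Rightarrow> bool" where
  "state_on R \<tau> \<longleftrightarrow>
     (\<forall>A\<in>R. \<forall>B\<in>R. \<tau> (A + B) = \<tau> A + \<tau> B) \<and> (\<forall>c. \<forall>A\<in>R. \<tau> (scalar_op c o\<^sub>L A) = c * \<tau> A) \<and>
     (\<forall>A\<in>R. positive_op A \<longrightarrow> \<tau> A \<in> \<real>\<^sub>\<ge>\<^sub>0) \<and> \<tau> id_blinfun = 1"

definition tracial_on ::
    "('h::complex_hilbert \<Rightarrow>\<^sub>L 'h) set \<Rightarrow> (('h \<Rightarrow>\<^sub>L 'h) \<Rightarrow> complex) \<Rightarrow> bool" where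
  "tracial_on R \<tau> \<longleftrightarrow> (\<forall>A\<in>R. \<forall>B\<in>R. \<tau> (A o\<^sub>L B) = \<tau> (B o\<^sub>L A))"

definition faithful_on ::
    "('h::complex_hilbert \<Rightarrow>\<^sub>L 'h) set \<Rightarrow> (('h \<Rightarrow>\<^sub>L 'h) \<Rightarrow> complex) \<Rightarrow> bool" where
  "faithful_on R \<tau> \<longleftrightarrow> (\<forall>A\<in>R. \<tau> (cadjoint A o\<^sub>L A) = 0 \<longrightarrow> A = 0)"

definition is_lub_op ::
    "('h::complex_hilbert \<Rightarrow>\<^sub>L 'h) set \<Rightarrow> ('h \<Rightarrow>\<^sub>L 'h) set \<Rightarrow> ('h \<Rightarrow>\<^sub>L 'h) \<Rightarrow> bool" where
  "is_lub_op R D T \<longleftrightarrow> T \<in> R \<and> selfadjoint_op T \<and> (\<forall>X\<in>D. X \<le>\<^sub>o\<^sub>p T) \<and>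
     (\<forall>U\<in>R. selfadjoint_op U \<and> (\<forall>X\<in>D. X \<le>\<^sub>o\<^sub>p U) \<longrightarrow> T \<le>\<^sub>o\<^sub>p U)"

text \<open>
  \<open>\<tau>(X)\<close> converges to \<open>\<tau>(T)\<close> along every increasing net of self-adjoint operators with least
  upper bound \<open>T\<close>; the nets are represented by their ranges, which are upward directed sets.
\<close>

definition normal_on ::
    "('h::complex_hilbert \<Rightarrow>\<^sub>L 'h) set \<Rightarrow> (('h \<Rightarrow>\<^sub>L 'h) \<Rightarrow> complex) \<Rightarrow> bool" where
  "normal_on R \<tau> \<longleftrightarrow> (\<forall>D T. D \<subseteq> R \<and> D \<noteq> {} \<and> (\<forall>X\<in>D. selfadjoint_op X) \<and>
     (\<forall>X\<in>D. \<forall>Y\<in>D. \<exists>Z\<in>D. X \<le>\<^sub>o\<^sub>p Z \<and> Y \<le>\<^sub>o\<^sub>p Z) \<and> is_lub_op R D T \<longrightarrow>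
     (\<forall>e>0. \<exists>X\<in>D. \<forall>Y\<in>D. X \<le>\<^sub>o\<^sub>p Y \<longrightarrow> cmod (\<tau> Y - \<tau> T) < e))"

definition faithful_normal_tracial_state ::
    "('h::complex_hilbert \<Rightarrow>\<^sub>L 'h) set \<Rightarrow> (('h \<Rightarrow>\<^sub>L 'h) \<Rightarrow> complex) \<Rightarrow> bool" where
  "faithful_normal_tracial_state R \<tau> \<longleftrightarrow>
     state_on R \<tau> \<and> tracial_on R \<tau> \<and> faithful_on R \<tau> \<and> normal_on R \<tau>"


section \<open>Conditional expectations and the Fuglede--Kadison determinant\<close>

definition conditional_expectation ::
    "('h::complex_hilbert \<Rightarrow>\<^sub>L 'h) set \<Rightarrow> ('h \<Rightarrow>\<^sub>L 'h) set \<Rightarrow> (('h \<Rightarrow>\<^sub>L 'h) \<Rightarrow> 'h \<Rightarrow>\<^sub>L 'h) \<Rightarrow> bool" where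
  "conditional_expectation R S \<Phi> \<longleftrightarrow> \<Phi> \<in> R \<rightarrow> S \<and>
     (\<forall>A\<in>R. \<forall>B\<in>R. \<Phi> (A + B) = \<Phi> A + \<Phi> B) \<and>
     (\<forall>c. \<forall>A\<in>R. \<Phi> (scalar_op c o\<^sub>L A) = scalar_op c o\<^sub>L \<Phi> A) \<and>
     (\<forall>A\<in>R. positive_op A \<longrightarrow> positive_op (\<Phi> A)) \<and> \<Phi> id_blinfun = id_blinfun \<and>
     (\<forall>A\<in>R. \<forall>S1\<in>S. \<forall>S2\<in>S. \<Phi> (S1 o\<^sub>L A o\<^sub>L S2) = S1 o\<^sub>L \<Phi> A o\<^sub>L S2)"

text \<open>
  Meant for regular \<open>A\<close>; the logarithm is then self-adjoint, so its trace is real and taking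
  the real part only changes the type.
\<close>

definition FK_det :: "(('h::complex_hilbert \<Rightarrow>\<^sub>L 'h) \<Rightarrow> complex) \<Rightarrow> ('h \<Rightarrow>\<^sub>L 'h) \<Rightarrow> real" where
  "FK_det \<tau> A = exp (Re (\<tau> (cfc ln (cfc sqrt (cadjoint A o\<^sub>L A)))))"

end

(*
  Write B for the conditional expectation of A. An operator monotone function on (0,\<infinity>) is monotone for
  2x2 matrices, which already makes f concave and, being non-constant, strictly increasing; hence ln o f
  is strongly concave, i.e. g(t) = ln f(t) + c t^2 is concave for some c > 0, on a compact interval J
  containing the spectra of A and B.

  A continuous function d that is up to \<epsilon> a supergradient of g, for instance a difference quotient, satisfies
  g(s) <= g(t) + (s - t) d(t) + \<epsilon> on J x J. Klein's argument integrates this to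
  \<tau>(g(A)) <= \<tau>(g(B)) + \<tau>((A - B) d(B)) + \<epsilon>, where \<tau>((A - B) d(B)) = 0 because the expectation is a
  \<tau>-preserving module map. Letting \<epsilon> tend to 0 and using \<tau>(A^2) - \<tau>(B^2) = \<tau>((A - B)^2) gives
  \<tau>(ln f(A)) + c \<tau>((A - B)^2) <= \<tau>(ln f(B)), which is the inequality together with its equality case, since
  \<tau> is faithful.
*)
theory Submission
  imports Defs "HOL-Computational_Algebra.Fundamental_Theorem_Algebra"
begin

text \<open>\<open>A\<close> and \<open>\<Phi> A\<close> need not commute, so no joint spectral
  measure integrates the scalar inequality over pairs (s, t). What survives is that a product of two
  positive operators has non-negative trace. This suffices because the inequality is affine in s
  apart from one function of s alone: each fixed t gives a positive operator in \<open>A\<close>,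
  and the weights are positive operators in \<open>\<Phi> A\<close>. Difference quotients appear
  because only concavity is extracted from operator monotonicity; a concave function may have kinks,
  where its one-sided derivatives jump and leave the continuous functional calculus. All calculus
  takes place on an interval that bounds quadratic forms, since a positive unital map respects such
  bounds. It rests on one estimate for real polynomials p, that the norm of p(A) is at most the
  supremum of |p| on the spectrum: \<open>cfc\<close> is a definite description, which is usable
  only once approximating polynomials are known to converge.\<close>

instance complex_hilbert \<subseteq> banach ..

section \<open>Hermitian operators\<close>

lemma cinner_add_right: "cinner x (y + z) = cinner x y + cinner (x::'a::complex_hilbert) z"
  by (metis cinner_add_left cinner_commute complex_cnj_add)

lemma cinner_scaleC_right: "cinner x (c *\<^sub>C y) = cnj c * cinner (x::'a::complex_hilbert) y"
  by (metis cinner_commute cinner_scaleC_left complex_cnj_mult)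

lemma cinner_scaleR_left: "cinner (r *\<^sub>R x) y = of_real r * cinner (x::'a::complex_hilbert) y"
  by (metis cinner_scaleC_left scaleC_of_real)

lemma cinner_scaleR_right: "cinner x (r *\<^sub>R y) = of_real r * cinner (x::'a::complex_hilbert) y"
  by (metis cinner_scaleC_right scaleC_of_real complex_cnj_complex_of_real)

lemma cinner_minus_left: "cinner (- x) y = - cinner (x::'a::complex_hilbert) y"
  using cinner_scaleR_left[of "-1" x y] by simp

lemma cinner_diff_left: "cinner (x - y) z = cinner x z - cinner (y::'a::complex_hilbert) z"
  using cinner_add_left[of x "- y" z] by (simp add: cinner_minus_left)

lemma Im_cinner: "Im (cinner x y) = inner x (\<i> *\<^sub>C (y::'a::complex_hilbert))"
  by (simp add: cinner_scaleC_right flip: Re_cinner)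

lemma cinner_self: "cinner x x = of_real ((norm (x::'a::complex_hilbert))\<^sup>2)"
proof -
  have "Im (cinner x x) = 0"
    using arg_cong[OF cinner_commute[of x x], of Im] by simp
  then show ?thesis
    by (simp add: complex_eq_iff Re_cinner power2_norm_eq_inner)
qed

lemma scaleC_zero_right [simp]: "c *\<^sub>C (0::'a::complex_hilbert) = 0"
  by (rule linear_0, rule bounded_linear.linear, rule bounded_linear_scaleC)

lemma scaleC_diff_right: "c *\<^sub>C (x - y) = c *\<^sub>C x - c *\<^sub>C (y::'a::complex_hilbert)"
  by (rule linear_diff, rule bounded_linear.linear, rule bounded_linear_scaleC)

lemma scaleC_scaleR: "c *\<^sub>C (r *\<^sub>R x) = r *\<^sub>R (c *\<^sub>C (x::'a::complex_hilbert))"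
  by (rule linear_scale, rule bounded_linear.linear, rule bounded_linear_scaleC)

lemma scaleC_decomp: "c *\<^sub>C x = Re c *\<^sub>R x + Im c *\<^sub>R (\<i> *\<^sub>C (x::'a::complex_hilbert))"
proof -
  have "c *\<^sub>C x = (of_real (Re c) + of_real (Im c) * \<i>) *\<^sub>C x"
    by (rule arg_cong[where f="\<lambda>d. d *\<^sub>C x"]) (simp add: complex_eq_iff)
  also have "\<dots> = Re c *\<^sub>R x + Im c *\<^sub>R (\<i> *\<^sub>C x)"
    unfolding scaleC_add_left scaleC_of_real by (simp only: scaleC_of_real flip: scaleC_scaleC)
  finally show ?thesis .
qed

lemma scalar_op_of_real: "scalar_op (of_real r) = r *\<^sub>R id_blinfun"
  by (rule blinfun_eqI) (simp add: scalar_op.rep_eq scaleC_of_real scaleR_blinfun.rep_eq)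

lemma scalar_op_of_real_compose: "scalar_op (of_real r) o\<^sub>L A = r *\<^sub>R A"
  by (rule blinfun_eqI) (simp add: scalar_op.rep_eq scaleC_of_real scaleR_blinfun.rep_eq)

lemma clinear_opsD: "A \<in> clinear_ops \<Longrightarrow> blinfun_apply A (c *\<^sub>C x) = c *\<^sub>C blinfun_apply A x"
  by (simp add: clinear_ops_def)

text \<open>\<open>cadjoint\<close> is a definite description and awkward to handle directly;
  symmetry for the real inner product is checked pointwise and survives limits. Complex linearity
  extends it to \<open>cinner\<close>.\<close>

definition hermitian_op :: "('h::complex_hilbert \<Rightarrow>\<^sub>L 'h) \<Rightarrow> bool" where
  "hermitian_op A \<longleftrightarrow> A \<in> clinear_ops \<and> (\<forall>x y. inner (A x) y = inner x (A y))"

lemma hermitian_op_clinear: "hermitian_op A \<Longrightarrow> A \<in> clinear_ops"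
  by (simp add: hermitian_op_def)

lemma hermitian_op_inner: "hermitian_op A \<Longrightarrow> inner (A x) y = inner x (A y)"
  by (simp add: hermitian_op_def)

lemma hermitian_op_cinner:
  assumes "hermitian_op A"
  shows "cinner (A x) y = cinner x (A y)"
  using assms by (simp add: complex_eq_iff Re_cinner Im_cinner hermitian_op_def clinear_opsD)

lemma cadjoint_unique:
  fixes A B :: "'h::complex_hilbert \<Rightarrow>\<^sub>L 'h"
  assumes "\<And>x y. cinner (A x) y = cinner x (B y)"
  shows "cadjoint A = B"
  unfolding cadjoint_def
proof (rule the_equality)
  show "\<forall>x y. cinner (A x) y = cinner x (B y)"
    using assms by blast
  fix C :: "'h \<Rightarrow>\<^sub>L 'h"
  assume C: "\<forall>x y. cinner (A x) y = cinner x (C y)"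
  show "C = B"
  proof (rule blinfun_eqI)
    fix y
    have "inner x (C y) = inner x (B y)" for x
      using C assms by (metis Re_cinner)
    then show "C y = B y"
      using vector_eq_ldot[of "C y" "B y"] by simp
  qed
qed

lemma hermitian_op_cadjoint: "hermitian_op A \<Longrightarrow> cadjoint A = A"
  by (rule cadjoint_unique) (rule hermitian_op_cinner)

lemma hermitian_op_selfadjoint: "hermitian_op A \<Longrightarrow> selfadjoint_op A"
  by (simp add: selfadjoint_op_def hermitian_op_cadjoint hermitian_op_clinear)

lemma positive_op_iff:
  "positive_op A \<longleftrightarrow> hermitian_op A \<and> (\<forall>x. 0 \<le> inner (A x) x)"
proof
  assume A: "positive_op A"
  then have lin: "A \<in> clinear_ops" and nn: "\<And>x. cinner (A x) x \<in> \<real>\<^sub>\<ge>\<^sub>0"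
    by (auto simp: positive_op_def)
  have Im: "Im (cinner (A x) x) = 0" for x
    using nn[of x] by (auto simp: complex_nonneg_Reals_iff)
  have "inner (A x) y = inner x (A y)" for x y
  proof -
    \<comment> \<open>Polarization: the form is real at x, y and x + i y, so the imaginary part of
      the cross terms vanishes, which is the symmetry of \<open>A\<close>.\<close>
    have "Im (cinner (A (x + \<i> *\<^sub>C y)) (x + \<i> *\<^sub>C y)) = Re (cinner (A y) x) - Re (cinner (A x) y)"
      using Im[of x] Im[of y]
      by (simp add: blinfun.add_right clinear_opsD[OF lin] cinner_add_left cinner_add_right
          cinner_scaleC_left cinner_scaleC_right)
    then show ?thesis
      using Im[of "x + \<i> *\<^sub>C y"] by (simp add: Re_cinner inner_commute)
  qed
  moreover have "0 \<le> inner (A x) x" for x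
    using nn[of x] by (auto simp: complex_nonneg_Reals_iff Re_cinner)
  ultimately show "hermitian_op A \<and> (\<forall>x. 0 \<le> inner (A x) x)"
    using lin by (simp add: hermitian_op_def)
next
  assume A: "hermitian_op A \<and> (\<forall>x. 0 \<le> inner (A x) x)"
  have "Im (cinner (A x) x) = 0" for x
  proof -
    have "cinner (A x) x = cnj (cinner (A x) x)"
      using A by (metis hermitian_op_cinner cinner_commute)
    then show ?thesis
      by (metis Im_complex_of_real Reals_cases complex_cnj_cancel_iff Reals_cnj_iff)
  qed
  with A show "positive_op A"
    by (auto simp: positive_op_def complex_nonneg_Reals_iff Re_cinner hermitian_op_clinear)
qed

lemma clinear_ops_closed:
  shows clinear_ops_id: "id_blinfun \<in> clinear_ops"
    and clinear_ops_add: "A \<in> clinear_ops \<Longrightarrow> B \<in> clinear_ops \<Longrightarrow> A + B \<in> clinear_ops"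
    and clinear_ops_diff: "A \<in> clinear_ops \<Longrightarrow> B \<in> clinear_ops \<Longrightarrow> A - B \<in> clinear_ops"
    and clinear_ops_scaleR: "A \<in> clinear_ops \<Longrightarrow> r *\<^sub>R A \<in> clinear_ops"
    and clinear_ops_compose: "A \<in> clinear_ops \<Longrightarrow> B \<in> clinear_ops \<Longrightarrow> A o\<^sub>L B \<in> clinear_ops"
    and clinear_ops_scalar: "scalar_op c \<in> clinear_ops"
  by (auto simp: clinear_ops_def blinfun.add_left blinfun.diff_left blinfun.scaleR_left
      scaleC_add_right scaleC_diff_right scaleC_scaleR scalar_op.rep_eq scaleC_scaleC mult.commute)

lemma hermitian_op_closed:
  shows hermitian_op_id: "hermitian_op id_blinfun"
    and hermitian_op_zero: "hermitian_op 0"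
    and hermitian_op_add: "hermitian_op A \<Longrightarrow> hermitian_op B \<Longrightarrow> hermitian_op (A + B)"
    and hermitian_op_diff: "hermitian_op A \<Longrightarrow> hermitian_op B \<Longrightarrow> hermitian_op (A - B)"
    and hermitian_op_scaleR: "hermitian_op A \<Longrightarrow> hermitian_op (r *\<^sub>R A)"
    and hermitian_op_conjugate: "hermitian_op A \<Longrightarrow> hermitian_op B \<Longrightarrow> hermitian_op (A o\<^sub>L B o\<^sub>L A)"
    and hermitian_op_compose:
      "hermitian_op A \<Longrightarrow> hermitian_op B \<Longrightarrow> A o\<^sub>L B = B o\<^sub>L A \<Longrightarrow> hermitian_op (A o\<^sub>L B)"
proof -
  show "hermitian_op (A o\<^sub>L B)" if "hermitian_op A" "hermitian_op B" "A o\<^sub>L B = B o\<^sub>L A" for A B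
  proof -
    have "inner (A (B x)) y = inner x (A (B y))" for x y
      using that by (metis hermitian_op_inner blinfun_apply_blinfun_compose)
    then show ?thesis
      using that by (simp add: hermitian_op_def clinear_ops_compose)
  qed
qed (auto simp: hermitian_op_def scaleC_add_right scaleC_diff_right scaleC_scaleR blinfun.add_left blinfun.diff_left blinfun.scaleR_left inner_add_left
    inner_add_right inner_diff_left inner_diff_right clinear_ops_def)

lemma clinear_ops_LIMSEQ:
  assumes "\<And>n. T n \<in> clinear_ops" and "T \<longlonglongrightarrow> A"
  shows "A \<in> clinear_ops"
proof -
  have "blinfun_apply A (c *\<^sub>C x) = c *\<^sub>C blinfun_apply A x" for c x
  proof (rule LIMSEQ_unique)
    show "(\<lambda>n. T n (c *\<^sub>C x)) \<longlonglongrightarrow> A (c *\<^sub>C x)"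
      by (intro tendsto_intros assms)
    show "(\<lambda>n. T n (c *\<^sub>C x)) \<longlonglongrightarrow> c *\<^sub>C A x"
      unfolding clinear_opsD[OF assms(1)]
      by (intro bounded_linear.tendsto[OF bounded_linear_scaleC] tendsto_intros assms)
  qed
  then show ?thesis
    by (simp add: clinear_ops_def)
qed

lemma hermitian_op_LIMSEQ:
  assumes "\<And>n. hermitian_op (T n)" and "T \<longlonglongrightarrow> A"
  shows "hermitian_op A"
proof -
  have "inner (A x) y = inner x (A y)" for x y
  proof (rule LIMSEQ_unique)
    show "(\<lambda>n. inner (T n x) y) \<longlonglongrightarrow> inner (A x) y"
      by (intro tendsto_intros assms)
    show "(\<lambda>n. inner (T n x) y) \<longlonglongrightarrow> inner x (A y)"
      unfolding hermitian_op_inner[OF assms(1)] by (intro tendsto_intros assms)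
  qed
  moreover have "A \<in> clinear_ops"
    using assms by (blast intro: clinear_ops_LIMSEQ hermitian_op_clinear)
  ultimately show ?thesis
    by (simp add: hermitian_op_def)
qed

lemma positive_op_square:
  assumes "hermitian_op A"
  shows "positive_op (A o\<^sub>L A)"
  using assms by (simp add: positive_op_iff hermitian_op_compose hermitian_op_inner[of A "blinfun_apply A x" for x])

lemma abs_inner_blinfun_le:
  fixes A :: "'h::complex_hilbert \<Rightarrow>\<^sub>L 'h"
  shows "\<bar>inner (A x) x\<bar> \<le> norm A * (norm x)\<^sup>2"
proof -
  have "\<bar>inner (A x) x\<bar> \<le> norm (A x) * norm x"
    by (rule Cauchy_Schwarz_ineq2)
  also have "\<dots> \<le> norm A * norm x * norm x"
    by (intro mult_right_mono norm_blinfun) simp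
  finally show ?thesis
    by (simp add: power2_eq_square mult.assoc)
qed

section \<open>Polynomials of an operator\<close>

lemma blinfun_compose_minus_right: "A o\<^sub>L (B - C) = (A o\<^sub>L B) - (A o\<^sub>L C)"
  and blinfun_compose_minus_left: "(B - C) o\<^sub>L A = (B o\<^sub>L A) - (C o\<^sub>L A)"
  and blinfun_compose_plus_right: "A o\<^sub>L (B + C) = (A o\<^sub>L B) + (A o\<^sub>L C)"
  and blinfun_compose_plus_left: "(B + C) o\<^sub>L A = (B o\<^sub>L A) + (C o\<^sub>L A)"
  and blinfun_compose_scaleR_right: "A o\<^sub>L (r *\<^sub>R B) = r *\<^sub>R (A o\<^sub>L B)"
  and blinfun_compose_scaleR_left: "(r *\<^sub>R B) o\<^sub>L A = r *\<^sub>R (B o\<^sub>L A)"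
  by (rule blinfun_eqI, simp add: blinfun.bilinear_simps)+

lemmas blinfun_compose_distribs = blinfun_compose_minus_right blinfun_compose_minus_left
  blinfun_compose_plus_right blinfun_compose_plus_left
  blinfun_compose_scaleR_right blinfun_compose_scaleR_left

lemma id_blinfun_compose [simp]: "id_blinfun o\<^sub>L A = A"
  and compose_id_blinfun [simp]: "A o\<^sub>L id_blinfun = A"
  by (rule blinfun_eqI, simp)+

lemma blinfun_compose_assoc: "(A o\<^sub>L B) o\<^sub>L C = A o\<^sub>L (B o\<^sub>L C)"
  by (rule blinfun_eqI) simp

lemma poly_op_0 [simp]: "poly_op 0 A = 0"
  by (simp add: poly_op_def)

lemma poly_op_cover:
  assumes "degree p \<le> n"
  shows "poly_op p A = (\<Sum>i\<le>n. coeff p i *\<^sub>R (((o\<^sub>L) A ^^ i) id_blinfun))"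
  unfolding poly_op_def
  using assms by (intro sum.mono_neutral_left) (auto simp: coeff_eq_0)

text \<open>Horner's scheme, which turns the identities below into inductions over
  \<open>pCons\<close>.\<close>

lemma poly_op_pCons: "poly_op (pCons a p) A = a *\<^sub>R id_blinfun + (A o\<^sub>L poly_op p A)"
proof -
  have "poly_op (pCons a p) A
      = (\<Sum>i\<le>Suc (degree p). coeff (pCons a p) i *\<^sub>R (((o\<^sub>L) A ^^ i) id_blinfun))"
    by (rule poly_op_cover) (rule degree_pCons_le)
  also have "\<dots> = a *\<^sub>R id_blinfun
      + (\<Sum>i\<le>degree p. coeff p i *\<^sub>R (A o\<^sub>L ((o\<^sub>L) A ^^ i) id_blinfun))"
    by (simp only: sum.atMost_Suc_shift) simp
  also have "(\<Sum>i\<le>degree p. coeff p i *\<^sub>R (A o\<^sub>L ((o\<^sub>L) A ^^ i) id_blinfun)) = A o\<^sub>L poly_op p A"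
    by (simp only: poly_op_def bounded_bilinear.sum_right[OF bounded_bilinear_blinfun_compose]
        blinfun_compose_scaleR_right)
  finally show ?thesis .
qed

lemma poly_op_const: "poly_op [:a:] A = a *\<^sub>R id_blinfun"
  and poly_op_1: "poly_op 1 A = id_blinfun"
  and poly_op_X: "poly_op [:0, 1:] A = A"
  and poly_op_linear: "poly_op [:a, b:] A = a *\<^sub>R id_blinfun + b *\<^sub>R A"
  by (simp_all add: poly_op_pCons blinfun_compose_scaleR_right blinfun.zero_left one_pCons
      bounded_bilinear.zero_right[OF bounded_bilinear_blinfun_compose])

lemma poly_op_add: "poly_op (p + q) A = poly_op p A + poly_op q A"
proof (induction p arbitrary: q)
  case (pCons a p)
  show ?case
    by (cases q) (simp add: pCons(2) poly_op_pCons blinfun_compose_distribs scaleR_add_left)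
qed simp

lemma poly_op_smult: "poly_op (smult c p) A = c *\<^sub>R poly_op p A"
  by (induction p) (simp_all add: poly_op_pCons blinfun_compose_distribs algebra_simps)

lemma poly_op_diff: "poly_op (p - q) A = poly_op p A - poly_op q A"
  using poly_op_add[of p "- q" A] poly_op_smult[of "-1" q A] by simp

lemma poly_op_mult: "poly_op (p * q) A = poly_op p A o\<^sub>L poly_op q A"
  by (induction p)
    (simp_all add: poly_op_pCons poly_op_add poly_op_smult blinfun_compose_distribs
      blinfun_compose_assoc bounded_bilinear.zero_left[OF bounded_bilinear_blinfun_compose])

lemma poly_op_commute: "poly_op p A o\<^sub>L poly_op q A = poly_op q A o\<^sub>L poly_op p A"
  by (metis poly_op_mult mult.commute)

lemma poly_op_sum: "poly_op (sum p I) A = (\<Sum>i\<in>I. poly_op (p i) A)"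
  by (induction I rule: infinite_finite_induct) (simp_all add: poly_op_add)

lemma hermitian_op_poly:
  assumes "hermitian_op A"
  shows "hermitian_op (poly_op p A)"
proof (induction p)
  case 0
  show ?case by (simp add: hermitian_op_zero)
next
  case (pCons a p)
  have "A o\<^sub>L poly_op p A = poly_op p A o\<^sub>L A"
    using poly_op_commute[of "[:0, 1:]" A p] by (simp add: poly_op_X)
  then show ?case
    using assms pCons by (simp add: poly_op_pCons hermitian_op_closed)
qed

section \<open>Invertibility and the spectrum\<close>

lemma power2_norm_diff:
  "(norm (x - y))\<^sup>2 = (norm x)\<^sup>2 - 2 * inner x (y::'a::real_inner) + (norm y)\<^sup>2"
  by (simp add: power2_norm_eq_inner inner_diff_left inner_diff_right inner_commute)

text \<open>The Lax-Milgram argument: a solution of A x = y is a fixed point of the map x - (A x -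
  y) / K, a contraction for suitable K. Coercivity also gives injectivity and the bound 1 / \<delta>
  on the inverse.\<close>

lemma coercive_imp_regular:
  fixes A :: "'h::complex_hilbert \<Rightarrow>\<^sub>L 'h"
  assumes lin: "A \<in> clinear_ops" and \<delta>: "\<delta> > 0"
    and co: "\<And>x. \<delta> * (norm x)\<^sup>2 \<le> inner (A x) x"
  shows "regular_op A"
proof -
  define N where "N = norm A + \<delta>"
  have N: "N > 0" "\<delta> \<le> N" "norm (A x) \<le> N * norm x" for x
    using \<delta> norm_blinfun[of A x] by (simp_all add: N_def algebra_simps add_pos_nonneg add_nonneg_pos)
      (smt (verit) mult_nonneg_nonneg norm_ge_zero)
  \<comment> \<open>This K minimizes 1 - 2 \<delta> / K + N^2 / K^2. The minimum 1 - \<delta>^2 /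
    N^2 is the square of the contraction constant c; it is non-negative thanks to the summand
    \<delta> in N.\<close>
  define K where "K = N\<^sup>2 / \<delta>"
  have K: "K > 0"
    using N \<delta> by (simp add: K_def)
  define c where "c = sqrt (1 - \<delta>\<^sup>2 / N\<^sup>2)"
  have quot: "0 < \<delta>\<^sup>2 / N\<^sup>2" "\<delta>\<^sup>2 / N\<^sup>2 \<le> 1"
    using \<delta> N by (simp_all add: power_mono)
  then have c: "0 \<le> c" "c < 1" "c\<^sup>2 = 1 - \<delta>\<^sup>2 / N\<^sup>2"
    by (simp_all add: c_def)
  have contr: "norm (x - (1 / K) *\<^sub>R A x) \<le> c * norm x" for x
  proof (rule power2_le_imp_le)
    have "(norm (x - (1 / K) *\<^sub>R A x))\<^sup>2
        = (norm x)\<^sup>2 - 2 / K * inner (A x) x + (norm (A x))\<^sup>2 / K\<^sup>2"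
      unfolding power2_norm_diff by (simp add: inner_commute power_divide)
    also have "\<dots> \<le> (norm x)\<^sup>2 - 2 / K * (\<delta> * (norm x)\<^sup>2) + (N * norm x)\<^sup>2 / K\<^sup>2"
      using K N(3)[of x] co[of x]
      by (intro add_mono diff_mono mult_left_mono divide_right_mono power_mono) auto
    also have "\<dots> = (c * norm x)\<^sup>2"
      unfolding power_mult_distrib c(3) using N \<delta>
      by (simp add: K_def field_simps power2_eq_square)
    finally show "(norm (x - (1 / K) *\<^sub>R A x))\<^sup>2 \<le> (c * norm x)\<^sup>2" .
  qed (use c in simp)
  have "\<exists>x. A x = y" for y
  proof -
    define F where "F x = x - (1 / K) *\<^sub>R (A x - y)" for x
    have "dist (F x) (F z) \<le> c * dist x z" for x z
      using contr[of "x - z"] by (simp add: F_def dist_norm blinfun.diff_right algebra_simps)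
    then obtain x where "F x = x"
      using banach_fix_type[of c F] c by blast
    then show ?thesis
      using K by (auto simp: F_def)
  qed
  then obtain g where g: "A (g y) = y" for y
    by metis
  have inj: "x = z" if "A x = A z" for x z
    using co[of "x - z"] that \<delta> by (simp add: blinfun.diff_right mult_le_0_iff)
  have bl: "bounded_linear g"
  proof (rule bounded_linear_intro)
    show "g (x + y) = g x + g y" for x y
      by (rule inj) (simp add: g blinfun.add_right)
    show "g (r *\<^sub>R x) = r *\<^sub>R g x" for r x
      by (rule inj) (simp add: g blinfun.scaleR_right)
    show "norm (g x) \<le> norm x * (1 / \<delta>)" for x
    proof (cases "g x = 0")
      case False
      have "\<delta> * (norm (g x))\<^sup>2 \<le> norm x * norm (g x)"
        using co[of "g x"] norm_cauchy_schwarz[of x "g x"] by (simp add: g)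
      then show ?thesis
        using False \<delta> by (simp add: power2_eq_square field_simps)
    qed (use \<delta> in simp)
  qed
  define B where "B = Blinfun g"
  have B: "B x = g x" for x
    using bl by (simp add: B_def bounded_linear_Blinfun_apply)
  have "B \<in> clinear_ops"
    by (auto simp: clinear_ops_def B intro: inj simp: g clinear_opsD[OF lin])
  moreover have "A o\<^sub>L B = id_blinfun" "B o\<^sub>L A = id_blinfun"
    by (rule blinfun_eqI, simp add: B g inj)+
  ultimately show ?thesis
    using lin by (auto simp: regular_op_def)
qed

text \<open>If C inverts XY, then YC is a right inverse of X, commutation makes CY a left inverse,
  and the two coincide.\<close>

lemma regular_op_factor:
  fixes X Y :: "'h::complex_hilbert \<Rightarrow>\<^sub>L 'h"
  assumes "X \<in> clinear_ops" "Y \<in> clinear_ops" "X o\<^sub>L Y = Y o\<^sub>L X" "regular_op (X o\<^sub>L Y)"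
  shows "regular_op X"
proof -
  obtain C where C: "C \<in> clinear_ops" "(X o\<^sub>L Y) o\<^sub>L C = id_blinfun" "C o\<^sub>L (X o\<^sub>L Y) = id_blinfun"
    using assms(4) by (auto simp: regular_op_def)
  have r: "X o\<^sub>L (Y o\<^sub>L C) = id_blinfun" and l: "(C o\<^sub>L Y) o\<^sub>L X = id_blinfun"
    using C(2) C(3) unfolding blinfun_compose_assoc assms(3)[symmetric] by simp_all
  have "C o\<^sub>L Y = (C o\<^sub>L Y) o\<^sub>L (X o\<^sub>L (Y o\<^sub>L C))"
    using r by simp
  also have "\<dots> = Y o\<^sub>L C"
    using l by (simp flip: blinfun_compose_assoc)
  finally show ?thesis
    using r l assms C by (auto simp: regular_op_def intro!: bexI[of _ "Y o\<^sub>L C"] clinear_ops_compose)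
qed

text \<open>Means that 0 is not an approximate eigenvalue. It passes to products and involves no
  surjectivity, so it replaces regularity when polynomials in \<open>A\<close> are
  factorized.\<close>

definition bounded_below :: "('h::real_normed_vector \<Rightarrow>\<^sub>L 'h) \<Rightarrow> bool" where
  "bounded_below A \<longleftrightarrow> (\<exists>c>0. \<forall>x. c * norm x \<le> norm (A x))"

lemma regular_imp_bounded_below:
  fixes A :: "'h::complex_hilbert \<Rightarrow>\<^sub>L 'h"
  assumes "regular_op A"
  shows "bounded_below A"
proof -
  obtain B where B: "B o\<^sub>L A = id_blinfun"
    using assms by (auto simp: regular_op_def)
  have "norm x \<le> (norm B + 1) * norm (A x)" for x
  proof -
    have "norm x = norm (B (A x))"
      by (metis B blinfun_apply_blinfun_compose id_blinfun.rep_eq)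
    also have "\<dots> \<le> (norm B + 1) * norm (A x)"
      using norm_blinfun[of B "A x"] by (simp add: distrib_right add_increasing2)
    finally show ?thesis .
  qed
  moreover have "norm B + 1 > 0"
    by (simp add: add_nonneg_pos)
  ultimately show ?thesis
    unfolding bounded_below_def
    by (intro exI[of _ "1 / (norm B + 1)"]) (simp add: pos_divide_le_eq mult.commute)
qed

lemma bounded_below_compose:
  assumes "bounded_below A" "bounded_below B"
  shows "bounded_below (A o\<^sub>L B)"
proof -
  obtain a b where ab: "a > 0" "b > 0" "\<And>x. a * norm x \<le> norm (A x)" "\<And>x. b * norm x \<le> norm (B x)"
    using assms by (auto simp: bounded_below_def)
  have "a * b * norm x \<le> norm (A (B x))" for x
    using mult_left_mono[OF ab(4)[of x], of a] ab(3)[of "B x"] ab(1) by (simp only: mult.assoc) linarith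
  then show ?thesis
    using ab by (auto simp: bounded_below_def intro!: exI[of _ "a * b"])
qed

lemma coercive_imp_bounded_below:
  assumes "c > 0" "\<And>x. c * (norm x)\<^sup>2 \<le> inner (blinfun_apply A x) x"
  shows "bounded_below A"
  unfolding bounded_below_def
proof (intro exI[of _ c] conjI allI)
  fix x
  show "c * norm x \<le> norm (A x)"
  proof (cases "x = 0")
    case False
    have "c * norm x * norm x \<le> norm (A x) * norm x"
      using assms(2)[of x] norm_cauchy_schwarz[of "A x" x] by (simp add: power2_eq_square mult.assoc)
    then show ?thesis
      using False by simp
  qed simp
qed (fact assms(1))

text \<open>The polynomial is (X - a)^2 + b^2, with roots a + i b and a - i b; for nonzero b its
  value at \<open>A\<close> is therefore coercive.\<close>

lemma inner_poly_op_quadratic: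
  assumes "hermitian_op A"
  shows "inner (poly_op [:a\<^sup>2 + b\<^sup>2, -2 * a, 1:] A x) x = (norm (A x - a *\<^sub>R x))\<^sup>2 + b\<^sup>2 * (norm x)\<^sup>2"
proof -
  have eq: "poly_op [:a\<^sup>2 + b\<^sup>2, -2 * a, 1:] A x = (a\<^sup>2 + b\<^sup>2) *\<^sub>R x - (2 * a) *\<^sub>R A x + A (A x)"
    by (simp add: poly_op_pCons blinfun.bilinear_simps)
  show ?thesis
    unfolding eq
    by (simp add: power2_norm_diff inner_diff_left inner_add_left power_mult_distrib
        hermitian_op_inner[OF assms, of "A x"] algebra_simps flip: power2_norm_eq_inner)
qed

text \<open>Modulo the real quadratic polynomial with roots z and its conjugate, q leaves a
  remainder a + b X, and such a real polynomial with a non-real root is zero.\<close>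

lemma real_poly_quadratic_factor:
  fixes q :: "real poly" and z :: complex
  assumes root: "poly (map_poly of_real q) z = 0" and z: "Im z \<noteq> 0"
  shows "[:(Re z)\<^sup>2 + (Im z)\<^sup>2, -2 * Re z, 1:] dvd q"
proof -
  define ev where "ev p = poly (map_poly complex_of_real p) z" for p
  have ev_pCons: "ev (pCons a p) = of_real a + z * ev p" for a p
    by (simp add: ev_def map_poly_pCons)
  have ev_add: "ev (p + r) = ev p + ev r" for p r
  proof (induction p arbitrary: r)
    case 0
    show ?case by (simp add: ev_def)
  next
    case (pCons a p)
    show ?case
      by (cases r) (simp add: ev_pCons pCons(2) distrib_left)
  qed
  have ev_smult: "ev (smult a p) = of_real a * ev p" for a p
    by (induction p) (simp_all add: ev_pCons algebra_simps, simp add: ev_def)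
  have ev_mult: "ev (p * r) = ev p * ev r" for p r
    by (induction p) (simp_all add: ev_pCons ev_add ev_smult algebra_simps, simp add: ev_def)
  define d where "d = [:(Re z)\<^sup>2 + (Im z)\<^sup>2, -2 * Re z, 1:]"
  have "ev d = 0"
    by (simp add: d_def ev_pCons complex_eq_iff power2_eq_square algebra_simps) (simp add: ev_def)
  moreover have "q = d * (q div d) + q mod d"
    by simp
  ultimately have "ev (q mod d) = 0"
    using root by (metis ev_def ev_add ev_mult mult_zero_left add_0)
  moreover have "degree (q mod d) < 2"
    using degree_mod_less[of d q] by (auto simp: d_def)
  then have "coeff (q mod d) i = 0" if "i \<ge> 2" for i
    using that by (intro coeff_eq_0) simp
  then have "q mod d = [:coeff (q mod d) 0, coeff (q mod d) 1:]"
    by (intro poly_eqI) (simp add: coeff_pCons numeral_2_eq_2 split: nat.split)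
  then obtain a b where ab: "q mod d = [:a, b:]"
    by blast
  ultimately have "of_real a + z * of_real b = 0"
    by (simp add: ev_pCons) (simp add: ev_def)
  then have "b = 0" "a = 0"
    using z by (auto simp: complex_eq_iff)
  then show ?thesis
    using ab by (simp add: d_def mod_eq_0_iff_dvd)
qed

text \<open>One half of spectral mapping, by splitting off factors that are bounded below at
  \<open>A\<close>: a real root t of q lies outside the spectrum, so X - t gives a regular operator;
  a non-real root gives a coercive quadratic factor.\<close>

lemma bounded_below_poly_op:
  assumes A: "hermitian_op A" and "q \<noteq> 0"
    and "\<And>t. complex_of_real t \<in> spectrum_op A \<Longrightarrow> poly q t \<noteq> 0"
  shows "bounded_below (poly_op q A)"
  using assms(2,3)
proof (induction "degree q" arbitrary: q rule: less_induct)
  case less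
  show ?case
  proof (cases "degree q = 0")
    case True
    then obtain c where "q = [:c:]" "c \<noteq> 0"
      using less.prems(1) by (auto elim: degree_eq_zeroE)
    then show ?thesis
      by (auto simp: bounded_below_def poly_op_const blinfun.scaleR_left intro!: exI[of _ "\<bar>c\<bar>"])
  next
    case False
    have "degree (map_poly complex_of_real q) = degree q"
      by (simp add: degree_map_poly)
    with False obtain z where z: "poly (map_poly complex_of_real q) z = 0"
      using fundamental_theorem_of_algebra by (metis constant_degree)
    obtain d where d: "d dvd q" "bounded_below (poly_op d A)" "degree d > 0"
    proof (cases "Im z = 0")
      case True
      define t where "t = Re z"
      have "z = of_real t"
        using True by (simp add: t_def complex_eq_iff)
      have "poly (map_poly complex_of_real q) (of_real t) = of_real (poly q t)"
        by (induction q) (auto simp: map_poly_pCons)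
      with z \<open>z = of_real t\<close> have root: "poly q t = 0"
        by simp
      then have "regular_op (A - scalar_op (of_real t))"
        using less.prems(2)[of t] by (auto simp: spectrum_op_def)
      moreover have "poly_op [:-t, 1:] A = A - scalar_op (of_real t)"
        by (simp add: poly_op_linear scalar_op_of_real)
      ultimately have "bounded_below (poly_op [:-t, 1:] A)"
        by (simp add: regular_imp_bounded_below)
      then show ?thesis
        using that[of "[:-t, 1:]"] root by (simp add: poly_eq_0_iff_dvd)
    next
      case False
      have "bounded_below (poly_op [:(Re z)\<^sup>2 + (Im z)\<^sup>2, -2 * Re z, 1:] A)"
        by (rule coercive_imp_bounded_below[of "(Im z)\<^sup>2"])
          (use False in \<open>simp_all only: inner_poly_op_quadratic[OF A], simp_all\<close>)
      then show ?thesis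
        using that real_poly_quadratic_factor[OF z False] by force
    qed
    obtain r where r: "q = d * r"
      using d(1) by blast
    then have "r \<noteq> 0" "d \<noteq> 0" "degree r < degree q"
      using less.prems(1) d(3) by (auto simp: degree_mult_eq)
    moreover have "poly r t \<noteq> 0" if "complex_of_real t \<in> spectrum_op A" for t
      using less.prems(2)[OF that] by (simp add: r)
    ultimately have "bounded_below (poly_op r A)"
      using less.hyps by blast
    then show ?thesis
      using d(2) by (simp add: r poly_op_mult bounded_below_compose)
  qed
qed

text \<open>Vectors at which T nearly attains its norm N are approximate eigenvectors of T^2 for
  N^2. Indeed a lower bound c for T^2 - N^2, combined with |T T x| <= N |T x|, would improve the
  norm bound from N^2 to N^2 - c^2 / N^2.\<close>

lemma not_bounded_below_square_minus_norm:
  fixes T :: "'h::complex_hilbert \<Rightarrow>\<^sub>L 'h"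
  assumes T: "hermitian_op T" and "T \<noteq> 0"
  shows "\<not> bounded_below ((T o\<^sub>L T) - (norm T)\<^sup>2 *\<^sub>R id_blinfun)"
proof
  define N where "N = norm T"
  have N: "N > 0"
    using assms(2) by (simp add: N_def)
  assume "bounded_below ((T o\<^sub>L T) - (norm T)\<^sup>2 *\<^sub>R id_blinfun)"
  then obtain c where c: "c > 0" "\<And>x. c * norm x \<le> norm (T (T x) - N\<^sup>2 *\<^sub>R x)"
    by (auto simp: bounded_below_def blinfun.bilinear_simps N_def)
  define k where "k = N\<^sup>2 - c\<^sup>2 / N\<^sup>2"
  have bound: "(norm (T x))\<^sup>2 \<le> k * (norm x)\<^sup>2" for x
  proof -
    have "(c * norm x)\<^sup>2 \<le> (norm (T (T x) - N\<^sup>2 *\<^sub>R x))\<^sup>2"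
      using c by (intro power_mono) auto
    also have "\<dots> = (norm (T (T x)))\<^sup>2 - 2 * N\<^sup>2 * (norm (T x))\<^sup>2 + N\<^sup>2 * N\<^sup>2 * (norm x)\<^sup>2"
      unfolding power2_norm_diff using hermitian_op_inner[OF T, of "T x" x]
      by (simp add: power_mult_distrib power2_eq_square flip: power2_norm_eq_inner)
    also have "(norm (T (T x)))\<^sup>2 \<le> (N * norm (T x))\<^sup>2"
      unfolding N_def by (intro power_mono norm_blinfun) simp
    finally have "N\<^sup>2 * (norm (T x))\<^sup>2 \<le> N\<^sup>2 * N\<^sup>2 * (norm x)\<^sup>2 - c\<^sup>2 * (norm x)\<^sup>2"
      by (simp add: power_mult_distrib)
    then show ?thesis
      using N by (simp add: k_def field_simps)
  qed
  obtain x where "T x \<noteq> 0"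
    using assms(2) by (metis blinfun_eqI zero_blinfun.rep_eq)
  then have k: "k > 0"
    using bound[of x] by (smt (verit) mult_nonpos_nonneg zero_le_power2 zero_less_power2 norm_eq_zero)
  have "norm T \<le> sqrt k"
  proof (rule norm_blinfun_bound)
    show "norm (T x) \<le> sqrt k * norm x" for x
      by (rule power2_le_imp_le) (use bound[of x] k in \<open>simp_all add: power_mult_distrib\<close>)
  qed (use k in simp)
  then have "N\<^sup>2 \<le> k"
    using power_mono[of N "sqrt k" 2] k by (simp add: N_def)
  moreover have "c\<^sup>2 / N\<^sup>2 > 0"
    using c N by simp
  ultimately show False
    by (simp add: k_def)
qed

text \<open>With N the norm of p(A), the operator p(A)^2 - N^2 is not bounded below, so p^2 - N^2
  vanishes at some spectral point t, that is, |p t| = N.\<close>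

lemma norm_poly_op_le:
  fixes A :: "'h::complex_hilbert \<Rightarrow>\<^sub>L 'h"
  assumes A: "hermitian_op A" and "C \<ge> 0"
    and C: "\<And>t. complex_of_real t \<in> spectrum_op A \<Longrightarrow> \<bar>poly p t\<bar> \<le> C"
  shows "norm (poly_op p A) \<le> C"
proof (rule ccontr)
  assume "\<not> norm (poly_op p A) \<le> C"
  then have gt: "norm (poly_op p A) > C"
    by simp
  have square: "\<not> bounded_below (poly_op (r * r - [:(norm (poly_op r A))\<^sup>2:]) A)" if "poly_op r A \<noteq> 0" for r
    using not_bounded_below_square_minus_norm[OF hermitian_op_poly[OF A] that]
    by (simp add: poly_op_diff poly_op_mult poly_op_const)
  \<comment> \<open>A spectral point is wanted separately for the case that p^2 is the constant N^2:
    then \<open>q\<close> below is the zero polynomial and any point serves. The space is non-zero,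
    since otherwise p(A) = 0, against \<open>gt\<close>.\<close>
  have "\<exists>t. complex_of_real t \<in> spectrum_op A"
  proof (cases "A = 0")
    case True
    have "poly_op p A \<noteq> 0"
      using gt assms(2) by auto
    then obtain x :: 'h where "x \<noteq> 0"
      by (metis blinfun_eqI)
    then have "\<not> regular_op (A - scalar_op (of_real 0))"
      using regular_imp_bounded_below[of A]
      by (auto simp: True scalar_op_of_real[of 0, simplified] bounded_below_def mult_le_0_iff)
    then show ?thesis
      unfolding spectrum_op_def by blast
  next
    case False
    have "\<not> bounded_below (poly_op ([:0, 1:] * [:0, 1:] - [:(norm A)\<^sup>2:]) A)"
      using square[of "[:0, 1:]", unfolded poly_op_X] False by blast
    moreover have "[:0, 1:] * [:0, 1:] - [:(norm A)\<^sup>2:] \<noteq> 0"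
      by simp
    ultimately show ?thesis
      using bounded_below_poly_op[OF A] by blast
  qed
  then obtain s where s: "complex_of_real s \<in> spectrum_op A"
    by blast
  define q where "q = p * p - [:(norm (poly_op p A))\<^sup>2:]"
  have "\<not> bounded_below (poly_op q A)"
    using square[of p] gt assms(2) unfolding q_def by fastforce
  then obtain t where t: "complex_of_real t \<in> spectrum_op A" "poly q t = 0"
    using bounded_below_poly_op[OF A, of q] s by (cases "q = 0") auto
  then have "(norm (poly_op p A))\<^sup>2 = \<bar>poly p t\<bar>\<^sup>2"
    by (simp add: q_def power2_eq_square)
  then have "norm (poly_op p A) = \<bar>poly p t\<bar>"
    by (simp only: power2_eq_iff_nonneg norm_ge_zero abs_ge_zero)
  then show False
    using C[OF t(1)] gt by simp
qed

text \<open>Bounds on the quadratic form instead of the spectrum, because a positive unital map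
  visibly preserves them.\<close>

definition op_between :: "real \<Rightarrow> real \<Rightarrow> ('h::complex_hilbert \<Rightarrow>\<^sub>L 'h) \<Rightarrow> bool" where
  "op_between m M A \<longleftrightarrow> hermitian_op A \<and>
     (\<forall>x. m * (norm x)\<^sup>2 \<le> inner (A x) x \<and> inner (A x) x \<le> M * (norm x)\<^sup>2)"

lemma op_between_hermitian: "op_between m M A \<Longrightarrow> hermitian_op A"
  by (simp add: op_between_def)

lemma op_between_mono:
  assumes "op_between m M A" "m' \<le> m" "M \<le> M'"
  shows "op_between m' M' A"
  using assms mult_right_mono[OF assms(2) zero_le_power2] mult_right_mono[OF assms(3) zero_le_power2]
  unfolding op_between_def by (blast intro: order_trans)

text \<open>The product of A - z and A - cnj z is (A - Re z)^2 + (Im z)^2. It is coercive if z is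
  non-real, or real at positive distance from the interval, and invertibility passes to a commuting
  factor.\<close>

lemma spectrum_op_subset:
  fixes A :: "'h::complex_hilbert \<Rightarrow>\<^sub>L 'h"
  assumes "op_between m M A"
  shows "spectrum_op A \<subseteq> complex_of_real ` {m..M}"
proof
  fix z
  assume z: "z \<in> spectrum_op A"
  have A: "hermitian_op A"
    using assms by (rule op_between_hermitian)
  show "z \<in> complex_of_real ` {m..M}"
  proof (rule ccontr)
    assume nz: "z \<notin> complex_of_real ` {m..M}"
    define X where "X = A - scalar_op z"
    define Y where "Y = A - scalar_op (cnj z)"
    define Q where "Q = poly_op [:(Re z)\<^sup>2 + (Im z)\<^sup>2, -2 * Re z, 1:] A"
    have lin: "A \<in> clinear_ops"
      using A by (rule hermitian_op_clinear)
    have prod: "(A - scalar_op w) o\<^sub>L (A - scalar_op (cnj w))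
        = poly_op [:(Re w)\<^sup>2 + (Im w)\<^sup>2, -2 * Re w, 1:] A" for w
    proof (rule blinfun_eqI)
      fix x
      have "w *\<^sub>C A x + cnj w *\<^sub>C A x = (2 * Re w) *\<^sub>R A x"
        by (simp add: complex_add_cnj flip: scaleC_add_left scaleC_of_real)
      moreover have "w *\<^sub>C cnj w *\<^sub>C x = ((Re w)\<^sup>2 + (Im w)\<^sup>2) *\<^sub>R x"
        by (simp add: scaleC_scaleC complex_mult_cnj flip: scaleC_of_real)
      ultimately show "((A - scalar_op w) o\<^sub>L (A - scalar_op (cnj w))) x
          = poly_op [:(Re w)\<^sup>2 + (Im w)\<^sup>2, -2 * Re w, 1:] A x"
        by (simp add: poly_op_pCons blinfun.bilinear_simps scalar_op.rep_eq clinear_opsD[OF lin]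
            scaleC_diff_right algebra_simps)
    qed
    have "X o\<^sub>L Y = Q" "Y o\<^sub>L X = Q"
      using prod[of z] prod[of "cnj z"] by (simp_all add: X_def Y_def Q_def)
    moreover have "X \<in> clinear_ops" "Y \<in> clinear_ops"
      by (simp_all add: X_def Y_def lin clinear_ops_closed)
    moreover have "\<exists>\<delta>>0. \<forall>x. \<delta> * (norm x)\<^sup>2 \<le> inner (Q x) x"
    proof (cases "Im z = 0")
      case False
      then show ?thesis
        unfolding Q_def inner_poly_op_quadratic[OF A] by (intro exI[of _ "(Im z)\<^sup>2"]) simp
    next
      case True
      define t where "t = Re z"
      have "z = of_real t"
        using True by (simp add: t_def complex_eq_iff)
      then have "t < m \<or> M < t"
        using nz by force
      then obtain d where d: "d > 0" "d \<le> m - t \<or> d \<le> t - M"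
        by (metis diff_gt_0_iff_gt order_refl)
      have "d * norm x \<le> norm (A x - t *\<^sub>R x)" for x
      proof (cases "x = 0")
        case False
        have b: "m * (norm x)\<^sup>2 \<le> inner (A x) x" "inner (A x) x \<le> M * (norm x)\<^sup>2"
          using assms by (auto simp: op_between_def)
        have "d * (norm x)\<^sup>2 \<le> (m - t) * (norm x)\<^sup>2 \<or> d * (norm x)\<^sup>2 \<le> (t - M) * (norm x)\<^sup>2"
          using d(2) by (meson mult_right_mono zero_le_power2)
        then have "d * (norm x)\<^sup>2 \<le> \<bar>inner (A x - t *\<^sub>R x) x\<bar>"
          using b by (auto simp: inner_diff_left algebra_simps simp flip: power2_norm_eq_inner)
        also have "\<dots> \<le> norm (A x - t *\<^sub>R x) * norm x"
          by (rule Cauchy_Schwarz_ineq2)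
        finally show ?thesis
          using False by (simp add: power2_eq_square)
      qed simp
      then have "d\<^sup>2 * (norm x)\<^sup>2 \<le> (norm (A x - t *\<^sub>R x))\<^sup>2" for x
        using d(1) power_mono[of "d * norm x" _ 2] by (simp add: power_mult_distrib)
      then show ?thesis
        unfolding Q_def inner_poly_op_quadratic[OF A] using d(1) True
        by (intro exI[of _ "d\<^sup>2"]) (simp add: t_def)
    qed
    moreover have "Q \<in> clinear_ops"
      unfolding Q_def by (intro hermitian_op_clinear hermitian_op_poly A)
    ultimately have "regular_op X"
      using coercive_imp_regular[of Q] regular_op_factor[of X Y] by metis
    then show False
      using z by (simp add: X_def spectrum_op_def)
  qed
qed

lemma norm_le_of_op_between:
  assumes "op_between (-c) c A" and "c \<ge> 0"
  shows "norm A \<le> c"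
proof -
  have "\<bar>t\<bar> \<le> c" if "complex_of_real t \<in> spectrum_op A" for t
    using subsetD[OF spectrum_op_subset[OF assms(1)] that] by auto
  then have "norm (poly_op [:0, 1:] A) \<le> c"
    using assms by (intro norm_poly_op_le) (auto simp: op_between_def)
  then show ?thesis
    by (simp add: poly_op_X)
qed

section \<open>Continuous functional calculus on an interval\<close>

text \<open>The Bernstein basis moved from [0, 1] to [m, M]. Its members are non-negative there and
  sum to 1, so besides approximating functions they are the partition of unity in
  \<open>Klein_inequality\<close>.\<close>

definition bernstein_poly :: "real \<Rightarrow> real \<Rightarrow> nat \<Rightarrow> nat \<Rightarrow> real poly" where
  "bernstein_poly m M n k = smult (of_nat (n choose k))
     ([:- m / (M - m), 1 / (M - m):] ^ k * (1 - [:- m / (M - m), 1 / (M - m):]) ^ (n - k))"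

lemma poly_bernstein_poly: "poly (bernstein_poly m M n k) t = Bernstein n k ((t - m) / (M - m))"
proof -
  have "poly [:- m / (M - m), 1 / (M - m):] t = (t - m) / (M - m)"
    by (simp add: diff_divide_distrib)
  then show ?thesis
    by (simp only: bernstein_poly_def Bernstein_def poly_smult poly_mult poly_power poly_diff poly_1 mult.assoc)
qed

lemma bernstein_poly_nonneg:
  assumes "m < M" "t \<in> {m..M}"
  shows "poly (bernstein_poly m M n k) t \<ge> 0"
  unfolding poly_bernstein_poly using assms by (intro Bernstein_nonneg) simp_all

lemma sum_bernstein_poly: "(\<Sum>k\<le>n. bernstein_poly m M n k) = 1"
  unfolding poly_eq_poly_eq_iff[symmetric] by (simp add: fun_eq_iff poly_sum poly_bernstein_poly)

lemma uniform_limit_bernstein: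
  assumes "m < M" and cont: "continuous_on {m..M} f"
  shows "uniform_limit {m..M}
    (\<lambda>n. poly (\<Sum>k\<le>n. smult (f (m + (M - m) * (real k / real n))) (bernstein_poly m M n k))) f sequentially"
proof (rule uniform_limitI)
  fix e :: real
  assume e: "e > 0"
  have "continuous_on {0..1} (\<lambda>u. f (m + (M - m) * u))"
  proof (rule continuous_on_compose2[OF cont])
    show "(\<lambda>u. m + (M - m) * u) ` {0..1} \<subseteq> {m..M}"
    proof (intro image_subsetI)
      fix u :: real
      assume "u \<in> {0..1}"
      then have "0 \<le> (M - m) * u" "(M - m) * u \<le> M - m"
        using assms(1) by (simp_all add: mult_left_le)
      then show "m + (M - m) * u \<in> {m..M}"
        unfolding atLeastAtMost_iff by linarith
    qed
  qed (intro continuous_intros)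
  from Bernstein_Weierstrass[OF this e] obtain N where N:
    "\<And>n u. N \<le> n \<Longrightarrow> u \<in> {0..1} \<Longrightarrow> \<bar>f (m + (M - m) * u) - (\<Sum>k\<le>n. f (m + (M - m) * (k / n)) * Bernstein n k u)\<bar> < e"
    by blast
  have "dist (poly (\<Sum>k\<le>n. smult (f (m + (M - m) * (real k / real n))) (bernstein_poly m M n k)) t) (f t) < e"
    if "N \<le> n" "t \<in> {m..M}" for n t
    using N[OF that(1), of "(t - m) / (M - m)"] that(2) assms(1)
    by (simp add: poly_sum poly_bernstein_poly dist_real_def abs_minus_commute)
  then show "\<forall>\<^sub>F n in sequentially. \<forall>t\<in>{m..M}.
      dist (poly (\<Sum>k\<le>n. smult (f (m + (M - m) * (real k / real n))) (bernstein_poly m M n k)) t) (f t) < e"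
    unfolding eventually_sequentially by blast
qed

text \<open>Stated for two sequences at once: \<open>q = p\<close> gives the Cauchy property, and
  distinct ones show that the limit does not depend on the approximation.\<close>

lemma poly_op_uniform_Cauchy:
  assumes A: "hermitian_op A" and "e > 0"
    and p: "uniform_limit {t. complex_of_real t \<in> spectrum_op A} (\<lambda>n. poly (p n)) f sequentially"
    and q: "uniform_limit {t. complex_of_real t \<in> spectrum_op A} (\<lambda>n. poly (q n)) f sequentially"
  shows "\<exists>N. \<forall>i\<ge>N. \<forall>j\<ge>N. norm (poly_op (p i) A - poly_op (q j) A) < e"
proof -
  obtain N1 where
    N1: "\<And>n t. n \<ge> N1 \<Longrightarrow> complex_of_real t \<in> spectrum_op A \<Longrightarrow> dist (poly (p n) t) (f t) < e / 4"
    using p[unfolded uniform_limit_sequentially_iff, rule_format, of "e / 4"] \<open>e > 0\<close> by auto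
  obtain N2 where
    N2: "\<And>n t. n \<ge> N2 \<Longrightarrow> complex_of_real t \<in> spectrum_op A \<Longrightarrow> dist (poly (q n) t) (f t) < e / 4"
    using q[unfolded uniform_limit_sequentially_iff, rule_format, of "e / 4"] \<open>e > 0\<close> by auto
  have bound: "norm (poly_op (p i - q j) A) \<le> e / 2" if "i \<ge> max N1 N2" "j \<ge> max N1 N2" for i j
  proof (rule norm_poly_op_le[OF A])
    fix t
    assume t: "complex_of_real t \<in> spectrum_op A"
    have "dist (poly (p i) t) (poly (q j) t) < e / 4 + e / 4"
      using N1[OF _ t, of i] N2[OF _ t, of j] that by (intro dist_triangle_less_add) auto
    then show "\<bar>poly (p i - q j) t\<bar> \<le> e / 2"
      by (simp add: dist_real_def)
  qed (use \<open>e > 0\<close> in simp)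
  have "norm (poly_op (p i - q j) A) < e" if "i \<ge> max N1 N2" "j \<ge> max N1 N2" for i j
    using bound[OF that] \<open>e > 0\<close> by simp
  then show ?thesis
    unfolding poly_op_diff by blast
qed

text \<open>The description in \<open>cfc_def\<close> quantifies over approximating sequences; if
  there were none, every operator would satisfy it. The given \<open>p\<close> thus provides
  uniqueness as well as the limit.\<close>

lemma cfc_LIMSEQ_spectrum:
  assumes A: "hermitian_op A"
    and p: "uniform_limit {t. complex_of_real t \<in> spectrum_op A} (\<lambda>n. poly (p n)) f sequentially"
  shows "(\<lambda>n. poly_op (p n) A) \<longlonglongrightarrow> cfc f A"
proof -
  have "Cauchy (\<lambda>n. poly_op (p n) A)"
  proof (rule metric_CauchyI)
    fix e :: real
    assume "e > 0"
    then show "\<exists>N. \<forall>i\<ge>N. \<forall>j\<ge>N. dist (poly_op (p i) A) (poly_op (p j) A) < e"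
      unfolding dist_norm by (rule poly_op_uniform_Cauchy[OF A _ p p])
  qed
  then obtain L where L: "(\<lambda>n. poly_op (p n) A) \<longlonglongrightarrow> L"
    using Cauchy_convergent by (auto simp: convergent_def)
  have "cfc f A = L"
    unfolding cfc_def
  proof (rule the_equality)
    show "T = L" if "\<forall>q. uniform_limit {t. complex_of_real t \<in> spectrum_op A} (\<lambda>n. poly (q n)) f sequentially
        \<longrightarrow> (\<lambda>n. poly_op (q n) A) \<longlonglongrightarrow> T" for T
      using that p L LIMSEQ_unique by blast
    show "\<forall>q. uniform_limit {t. complex_of_real t \<in> spectrum_op A} (\<lambda>n. poly (q n)) f sequentially
        \<longrightarrow> (\<lambda>n. poly_op (q n) A) \<longlonglongrightarrow> L"
    proof (intro allI impI)
      fix q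
      assume q: "uniform_limit {t. complex_of_real t \<in> spectrum_op A} (\<lambda>n. poly (q n)) f sequentially"
      have "(\<lambda>n. poly_op (q n) A - poly_op (p n) A) \<longlonglongrightarrow> 0"
      proof (rule LIMSEQ_I)
        fix e :: real
        assume "e > 0"
        then show "\<exists>N. \<forall>n\<ge>N. norm (poly_op (q n) A - poly_op (p n) A - 0) < e"
          using poly_op_uniform_Cauchy[OF A _ q p, of e] by auto
      qed
      from tendsto_add[OF this L] show "(\<lambda>n. poly_op (q n) A) \<longlonglongrightarrow> L"
        by simp
    qed
  qed
  with L show ?thesis
    by simp
qed

text \<open>An interval shared by \<open>A\<close> and \<open>\<Phi> A\<close> replaces their
  spectra, so the same polynomials approximate a function at both. Strictness keeps the Bernstein
  rescaling non-degenerate.\<close>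

locale op_interval =
  fixes m M :: real and A :: "'h::complex_hilbert \<Rightarrow>\<^sub>L 'h"
  assumes less: "m < M" and between: "op_between m M A"
begin

lemma hermitian: "hermitian_op A"
  using between by (rule op_between_hermitian)

lemma spectrum: "{t. complex_of_real t \<in> spectrum_op A} \<subseteq> {m..M}"
  using spectrum_op_subset[OF between] by auto

lemma cfc_LIMSEQ:
  assumes "uniform_limit {m..M} (\<lambda>n. poly (p n)) f sequentially"
  shows "(\<lambda>n. poly_op (p n) A) \<longlonglongrightarrow> cfc f A"
  using hermitian uniform_limit_on_subset[OF assms spectrum] by (rule cfc_LIMSEQ_spectrum)

lemma cfc_approx:
  assumes "continuous_on {m..M} f"
  obtains p where "uniform_limit {m..M} (\<lambda>n. poly (p n)) f sequentially"
    "(\<lambda>n. poly_op (p n) A) \<longlonglongrightarrow> cfc f A"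
  using that[OF uniform_limit_bernstein[OF less assms] cfc_LIMSEQ[OF uniform_limit_bernstein[OF less assms]]] .

lemma cfc_hermitian:
  assumes "continuous_on {m..M} f"
  shows "hermitian_op (cfc f A)"
  by (rule cfc_approx[OF assms]) (rule hermitian_op_LIMSEQ[OF hermitian_op_poly[OF hermitian]])

lemma cfc_mem_closed:
  assumes "continuous_on {m..M} f" "closed K" "\<And>p. poly_op p A \<in> K"
  shows "cfc f A \<in> K"
  by (rule cfc_approx[OF assms(1)]) (rule closed_sequentially[OF assms(2,3)])

lemma cfc_poly: "cfc (poly p) A = poly_op p A"
  using LIMSEQ_unique[OF cfc_LIMSEQ[of "\<lambda>_. p" "poly p"]] by (simp add: uniform_limit_const)

lemma cfc_cong:
  assumes "continuous_on {m..M} f" "\<And>t. t \<in> {m..M} \<Longrightarrow> f t = g t"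
  shows "cfc f A = cfc g A"
proof -
  obtain p where p: "uniform_limit {m..M} (\<lambda>n. poly (p n)) f sequentially"
    "(\<lambda>n. poly_op (p n) A) \<longlonglongrightarrow> cfc f A"
    using cfc_approx[OF assms(1)] by blast
  have "uniform_limit {m..M} (\<lambda>n. poly (p n)) g sequentially"
    using p(1) assms(2) by (subst uniform_limit_cong'[where g="\<lambda>n. poly (p n)" and i=f]) auto
  from LIMSEQ_unique[OF p(2) cfc_LIMSEQ[OF this]] show ?thesis .
qed

lemma cfc_add:
  assumes "continuous_on {m..M} f" "continuous_on {m..M} g"
  shows "cfc (\<lambda>t. f t + g t) A = cfc f A + cfc g A"
proof -
  obtain p where p: "uniform_limit {m..M} (\<lambda>n. poly (p n)) f sequentially"
      "(\<lambda>n. poly_op (p n) A) \<longlonglongrightarrow> cfc f A"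
    using cfc_approx[OF assms(1)] by blast
  obtain q where q: "uniform_limit {m..M} (\<lambda>n. poly (q n)) g sequentially"
      "(\<lambda>n. poly_op (q n) A) \<longlonglongrightarrow> cfc g A"
    using cfc_approx[OF assms(2)] by blast
  have "(\<lambda>n. poly (p n + q n)) = (\<lambda>n t. poly (p n) t + poly (q n) t)"
    by (simp add: fun_eq_iff)
  then have "uniform_limit {m..M} (\<lambda>n. poly (p n + q n)) (\<lambda>t. f t + g t) sequentially"
    using uniform_limit_add[OF p(1) q(1)] by simp
  from LIMSEQ_unique[OF cfc_LIMSEQ[OF this]] show ?thesis
    using tendsto_add[OF p(2) q(2)] by (simp add: poly_op_add)
qed

lemma cfc_mult:
  assumes "continuous_on {m..M} f" "continuous_on {m..M} g"
  shows "cfc (\<lambda>t. f t * g t) A = cfc f A o\<^sub>L cfc g A"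
proof -
  obtain p where p: "uniform_limit {m..M} (\<lambda>n. poly (p n)) f sequentially"
      "(\<lambda>n. poly_op (p n) A) \<longlonglongrightarrow> cfc f A"
    using cfc_approx[OF assms(1)] by blast
  obtain q where q: "uniform_limit {m..M} (\<lambda>n. poly (q n)) g sequentially"
      "(\<lambda>n. poly_op (q n) A) \<longlonglongrightarrow> cfc g A"
    using cfc_approx[OF assms(2)] by blast
  have "(\<lambda>n. poly (p n * q n)) = (\<lambda>n t. poly (p n) t * poly (q n) t)"
    by (simp add: fun_eq_iff)
  moreover have "bounded (f ` {m..M})" "bounded (g ` {m..M})"
    using assms by (simp_all add: compact_imp_bounded compact_continuous_image)
  ultimately have "uniform_limit {m..M} (\<lambda>n. poly (p n * q n)) (\<lambda>t. f t * g t) sequentially"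
    using uniform_lim_mult[OF p(1) q(1)] by simp
  from LIMSEQ_unique[OF cfc_LIMSEQ[OF this]] show ?thesis
    using bounded_bilinear.tendsto[OF bounded_bilinear_blinfun_compose p(2) q(2)]
    by (simp add: poly_op_mult)
qed

lemma cfc_const: "cfc (\<lambda>t. c) A = c *\<^sub>R id_blinfun"
  using cfc_poly[of "[:c:]"] by (simp add: poly_op_const cfc_cong[of "poly [:c:]" "\<lambda>t. c"])

lemma cfc_ident: "cfc (\<lambda>t. t) A = A"
  using cfc_poly[of "[:0, 1:]"] by (simp add: poly_op_X cfc_cong[of "poly [:0, 1:]" "\<lambda>t. t"])

lemma cfc_cmult:
  assumes "continuous_on {m..M} f"
  shows "cfc (\<lambda>t. c * f t) A = c *\<^sub>R cfc f A"
  using cfc_mult[OF continuous_on_const assms, of c]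
  by (simp add: cfc_const blinfun_compose_scaleR_left)

lemma cfc_diff:
  assumes "continuous_on {m..M} f" "continuous_on {m..M} g"
  shows "cfc (\<lambda>t. f t - g t) A = cfc f A - cfc g A"
  using cfc_add[OF assms(1) continuous_on_mult_left[OF assms(2), of "-1"]] cfc_cmult[OF assms(2), of "-1"]
  by simp

lemma cfc_square_root:
  assumes "continuous_on {m..M} f" "\<And>t. t \<in> {m..M} \<Longrightarrow> f t \<ge> 0"
  shows "cfc (\<lambda>t. sqrt (f t)) A o\<^sub>L cfc (\<lambda>t. sqrt (f t)) A = cfc f A"
proof -
  have s: "continuous_on {m..M} (\<lambda>t. sqrt (f t))"
    by (intro continuous_intros assms)
  show ?thesis
    unfolding cfc_mult[OF s s, symmetric] using assms
    by (intro cfc_cong continuous_intros) auto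
qed

lemma cfc_nonneg:
  assumes "continuous_on {m..M} f" "\<And>t. t \<in> {m..M} \<Longrightarrow> f t \<ge> 0"
  shows "positive_op (cfc f A)"
proof -
  have "continuous_on {m..M} (\<lambda>t. sqrt (f t))"
    by (intro continuous_intros assms)
  then show ?thesis
    using cfc_square_root[OF assms] by (metis positive_op_square cfc_hermitian)
qed

lemma op_between_cfc:
  assumes f: "continuous_on {m..M} f" and bounds: "\<And>t. t \<in> {m..M} \<Longrightarrow> f t \<in> {a..b}"
  shows "op_between a b (cfc f A)"
proof -
  have "positive_op (cfc f A - a *\<^sub>R id_blinfun)" "positive_op (b *\<^sub>R id_blinfun - cfc f A)"
    using cfc_nonneg[of "\<lambda>t. f t - a"] cfc_nonneg[of "\<lambda>t. b - f t"] f bounds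
    by (simp_all add: cfc_diff cfc_const continuous_intros)
  then show ?thesis
    by (simp add: op_between_def positive_op_iff cfc_hermitian[OF f] blinfun.bilinear_simps
        inner_diff_left power2_norm_eq_inner)
qed

lemma norm_cfc_le:
  assumes "continuous_on {m..M} f" "\<And>t. t \<in> {m..M} \<Longrightarrow> \<bar>f t\<bar> \<le> c"
  shows "norm (cfc f A) \<le> c"
proof (rule norm_le_of_op_between)
  show "op_between (- c) c (cfc f A)"
    using assms by (intro op_between_cfc) (auto simp: abs_le_iff minus_le_iff)
  show "c \<ge> 0"
    using assms(2)[of m] less by (simp add: abs_ge_zero order_trans)
qed

lemma poly_op_cfc:
  assumes "continuous_on {m..M} f"
  shows "poly_op p (cfc f A) = cfc (\<lambda>t. poly p (f t)) A"
proof (induction p)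
  case 0
  show ?case
    using cfc_const[of 0] by simp
next
  case (pCons a p)
  have c: "continuous_on {m..M} (\<lambda>t. poly p (f t))"
    by (intro continuous_intros assms)
  show ?case
    by (simp add: poly_op_pCons pCons.IH cfc_add cfc_mult cfc_const assms c continuous_intros)
qed

text \<open>For polynomials g this is \<open>poly_op_cfc\<close>; in general
  \<open>norm_cfc_le\<close> turns the uniform error of an approximation of g on [a, b] into an
  operator error.\<close>

lemma cfc_compose:
  assumes f: "continuous_on {m..M} f" and bounds: "\<And>t. t \<in> {m..M} \<Longrightarrow> f t \<in> {a..b}"
    and "a < b" and g: "continuous_on {a..b} g"
  shows "cfc g (cfc f A) = cfc (\<lambda>t. g (f t)) A"
proof -
  interpret fA: op_interval a b "cfc f A"
    using \<open>a < b\<close> op_between_cfc[OF f bounds] by unfold_locales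
  obtain p where p: "uniform_limit {a..b} (\<lambda>n. poly (p n)) g sequentially"
    "(\<lambda>n. poly_op (p n) (cfc f A)) \<longlonglongrightarrow> cfc g (cfc f A)"
    using fA.cfc_approx[OF g] by blast
  have gf: "continuous_on {m..M} (\<lambda>t. g (f t))"
    using bounds by (intro continuous_on_compose2[OF g f]) auto
  have "(\<lambda>n. poly_op (p n) (cfc f A)) \<longlonglongrightarrow> cfc (\<lambda>t. g (f t)) A"
  proof (rule LIMSEQ_I)
    fix e :: real
    assume "e > 0"
    then obtain N where N: "\<And>n s. n \<ge> N \<Longrightarrow> s \<in> {a..b} \<Longrightarrow> dist (poly (p n) s) (g s) < e / 2"
      using p(1)[unfolded uniform_limit_sequentially_iff, rule_format, of "e / 2"] half_gt_zero by blast
    have "norm (poly_op (p n) (cfc f A) - cfc (\<lambda>t. g (f t)) A) \<le> e / 2" if "n \<ge> N" for n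
    proof -
      have "poly_op (p n) (cfc f A) - cfc (\<lambda>t. g (f t)) A = cfc (\<lambda>t. poly (p n) (f t) - g (f t)) A"
        by (simp add: poly_op_cfc[OF f] cfc_diff gf f continuous_intros)
      also have "norm \<dots> \<le> e / 2"
        using N[OF that bounds] by (intro norm_cfc_le continuous_intros f gf) (simp add: dist_real_def less_imp_le)
      finally show ?thesis .
    qed
    moreover have "e / 2 < e"
      using \<open>e > 0\<close> by simp
    ultimately show "\<exists>N. \<forall>n\<ge>N. norm (poly_op (p n) (cfc f A) - cfc (\<lambda>t. g (f t)) A) < e"
      by (blast intro: le_less_trans)
  qed
  then show ?thesis
    using LIMSEQ_unique p(2) by blast
qed

lemma FK_det_cfc:
  assumes f: "continuous_on {m..M} f" and pos: "\<And>t. t \<in> {m..M} \<Longrightarrow> f t > 0"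
  shows "FK_det \<tau> (cfc f A) = exp (Re (\<tau> (cfc (\<lambda>t. ln (f t)) A)))"
proof -
  obtain a b where ab: "\<And>t. t \<in> {m..M} \<Longrightarrow> f t \<in> {a..b}" "a > 0" "a < b"
  proof -
    have ne: "{m..M} \<noteq> {}"
      using less by simp
    obtain s where s: "s \<in> {m..M}" "\<And>t. t \<in> {m..M} \<Longrightarrow> f s \<le> f t"
      using continuous_attains_inf[OF compact_Icc ne f] by blast
    obtain u where u: "u \<in> {m..M}" "\<And>t. t \<in> {m..M} \<Longrightarrow> f t \<le> f u"
      using continuous_attains_sup[OF compact_Icc ne f] by blast
    show ?thesis
    \<comment> \<open>The added 1 keeps a < b when f is constant on the interval; the minimum is
      positive, so [a, b] stays where \<open>ln\<close> is continuous.\<close>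
    proof (rule that[of "f s" "f u + 1"])
      show "f t \<in> {f s..f u + 1}" if "t \<in> {m..M}" for t
        using s(2)[OF that] u(2)[OF that] by simp
    qed (use pos[OF s(1)] s(2)[OF u(1)] in simp_all)
  qed
  have sq: "continuous_on {m..M} (\<lambda>t. f t * f t)"
    by (intro continuous_intros f)
  have "cadjoint (cfc f A) o\<^sub>L cfc f A = cfc (\<lambda>t. f t * f t) A"
    by (simp add: hermitian_op_cadjoint cfc_hermitian f cfc_mult)
  also have "cfc sqrt \<dots> = cfc (\<lambda>t. sqrt (f t * f t)) A"
  proof (rule cfc_compose[OF sq])
    show "f t * f t \<in> {a * a..b * b}" if "t \<in> {m..M}" for t
      using ab(1)[OF that] ab(2) mult_mono[of a "f t" a "f t"] mult_mono[of "f t" b "f t" b] by simp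
    show "a * a < b * b"
      using ab mult_strict_mono[of a b a b] by simp
  qed (intro continuous_intros)
  also have "\<dots> = cfc f A"
    by (intro cfc_cong continuous_intros f) (use pos in \<open>auto simp: less_imp_le\<close>)
  also have "cfc ln \<dots> = cfc (\<lambda>t. ln (f t)) A"
    using ab by (intro cfc_compose[OF f ab(1)] continuous_intros) auto
  finally show ?thesis
    by (simp add: FK_det_def)
qed

end

section \<open>Jensen's inequality for trace-preserving conditional expectations\<close>

lemma von_neumann_algebraD:
  assumes "von_neumann_algebra R"
  shows vN_id: "id_blinfun \<in> R"
    and vN_add: "A \<in> R \<Longrightarrow> B \<in> R \<Longrightarrow> A + B \<in> R"
    and vN_scalar: "A \<in> R \<Longrightarrow> scalar_op c o\<^sub>L A \<in> R"
    and vN_compose: "A \<in> R \<Longrightarrow> B \<in> R \<Longrightarrow> A o\<^sub>L B \<in> R"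
  using assms by (auto simp: von_neumann_algebra_def)

lemma vN_scaleR:
  assumes "von_neumann_algebra R" "A \<in> R"
  shows "r *\<^sub>R A \<in> R"
  using vN_scalar[OF assms, of "of_real r"] by (simp add: scalar_op_of_real_compose)

lemma vN_diff:
  assumes "von_neumann_algebra R" "A \<in> R" "B \<in> R"
  shows "A - B \<in> R"
  using vN_add[OF assms(1,2) vN_scaleR[OF assms(1,3), of "-1"]] by simp

lemma vN_poly_op:
  assumes R: "von_neumann_algebra R" and A: "A \<in> R"
  shows "poly_op p A \<in> R"
proof (induction p)
  case 0
  show ?case
    using vN_scaleR[OF R A, of 0] by simp
next
  case (pCons a p)
  then show ?case
    by (simp add: poly_op_pCons vN_add[OF R] vN_scaleR[OF R] vN_id[OF R] vN_compose[OF R] A)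
qed

text \<open>The norm topology is finer than the strong operator topology. Hence the functional
  calculus, a norm limit, stays in the algebra.\<close>

lemma vN_closed:
  assumes "von_neumann_algebra R"
  shows "closed R"
proof -
  have "closedin strong_operator_topology R"
    using assms by (simp add: von_neumann_algebra_def)
  then have "closedin euclidean {T \<in> topspace euclidean. T \<in> R}"
    by (rule closedin_continuous_map_preimage[OF strong_operator_topology_weaker_than_euclidean])
  then show ?thesis
    by simp
qed

lemma (in op_interval) vN_cfc:
  assumes "von_neumann_algebra R" "A \<in> R" "continuous_on {m..M} f"
  shows "cfc f A \<in> R"
  by (rule cfc_mem_closed[OF assms(3) vN_closed[OF assms(1)] vN_poly_op[OF assms(1,2)]])

section \<open>Trace estimates and the conditional expectation\<close>

locale trace_preserving_expectation =
  fixes R S :: "('h::complex_hilbert \<Rightarrow>\<^sub>L 'h) set"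
    and \<tau> :: "('h \<Rightarrow>\<^sub>L 'h) \<Rightarrow> complex"
    and \<Phi> :: "('h \<Rightarrow>\<^sub>L 'h) \<Rightarrow> 'h \<Rightarrow>\<^sub>L 'h"
  assumes R: "von_neumann_algebra R" and S: "von_neumann_algebra S" and S_sub_R: "S \<subseteq> R"
    and state: "state_on R \<tau>" and tracial: "tracial_on R \<tau>" and faithful: "faithful_on R \<tau>"
    and expectation: "conditional_expectation R S \<Phi>"
    and preserving: "\<And>X. X \<in> R \<Longrightarrow> \<tau> (\<Phi> X) = \<tau> X"
begin

abbreviation tr :: "('h \<Rightarrow>\<^sub>L 'h) \<Rightarrow> real" where
  "tr X \<equiv> Re (\<tau> X)"

lemma tr_add: "X \<in> R \<Longrightarrow> Y \<in> R \<Longrightarrow> tr (X + Y) = tr X + tr Y"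
  using state by (simp add: state_on_def)

lemma \<tau>_scaleR: "X \<in> R \<Longrightarrow> \<tau> (r *\<^sub>R X) = of_real r * \<tau> X"
  using state by (metis state_on_def scalar_op_of_real_compose)

lemma tr_scaleR: "X \<in> R \<Longrightarrow> tr (r *\<^sub>R X) = r * tr X"
  by (simp add: \<tau>_scaleR)

lemma tr_diff: "X \<in> R \<Longrightarrow> Y \<in> R \<Longrightarrow> tr (X - Y) = tr X - tr Y"
  using tr_add[OF _ vN_scaleR[OF R], of X Y "-1"] tr_scaleR[of Y "-1"] by simp

lemma tr_id: "tr id_blinfun = 1"
  using state by (simp add: state_on_def)

lemma tr_sum:
  assumes "finite I" "\<And>i. i \<in> I \<Longrightarrow> X i \<in> R"
  shows "tr (sum X I) = (\<Sum>i\<in>I. tr (X i)) \<and> sum X I \<in> R"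
  using assms
proof (induction I rule: finite_induct)
  case empty
  show ?case
    using tr_scaleR[OF vN_id[OF R], of 0] vN_scaleR[OF R vN_id[OF R], of 0] by simp
next
  case (insert i I)
  then show ?case
    by (simp add: tr_add vN_add[OF R])
qed

lemma tr_nonneg: "X \<in> R \<Longrightarrow> positive_op X \<Longrightarrow> tr X \<ge> 0"
  using state by (auto simp: state_on_def complex_nonneg_Reals_iff)

lemma tr_commute: "X \<in> R \<Longrightarrow> Y \<in> R \<Longrightarrow> tr (X o\<^sub>L Y) = tr (Y o\<^sub>L X)"
  using tracial by (simp add: tracial_on_def)

text \<open>A product of positive operators need not be positive, but under the trace one Y moves to
  the front and leaves the positive operator Y X Y.\<close>

lemma tr_mult_square_nonneg:
  assumes "X \<in> R" "Y \<in> R" "positive_op X" "hermitian_op Y"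
  shows "tr (X o\<^sub>L (Y o\<^sub>L Y)) \<ge> 0"
proof -
  have "tr (X o\<^sub>L (Y o\<^sub>L Y)) = tr ((X o\<^sub>L Y) o\<^sub>L Y)"
    by (simp add: blinfun_compose_assoc)
  also have "\<dots> = tr (Y o\<^sub>L (X o\<^sub>L Y))"
    using assms by (intro tr_commute vN_compose[OF R])
  also have "\<dots> = tr (Y o\<^sub>L X o\<^sub>L Y)"
    by (simp add: blinfun_compose_assoc)
  also have "\<dots> \<ge> 0"
  proof (rule tr_nonneg)
    show "positive_op (Y o\<^sub>L X o\<^sub>L Y)"
      using assms by (simp add: positive_op_iff hermitian_op_conjugate hermitian_op_inner[of Y])
  qed (use assms in \<open>simp add: vN_compose[OF R]\<close>)
  finally show ?thesis .
qed

lemma tr_le_norm: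
  assumes "X \<in> R" "hermitian_op X"
  shows "\<bar>tr X\<bar> \<le> norm X"
proof -
  have bounds: "0 \<le> norm X * (norm x)\<^sup>2 - inner (X x) x" "0 \<le> norm X * (norm x)\<^sup>2 + inner (X x) x" for x
    using abs_inner_blinfun_le[of X x] by linarith+
  have "tr (norm X *\<^sub>R id_blinfun - X) \<ge> 0"
  proof (rule tr_nonneg)
    show "positive_op (norm X *\<^sub>R id_blinfun - X)"
      using assms(2) bounds(1) by (simp add: positive_op_iff hermitian_op_closed
          blinfun.bilinear_simps inner_diff_left power2_norm_eq_inner)
  qed (intro vN_diff[OF R] vN_scaleR[OF R] vN_id[OF R] assms(1))
  moreover have "tr (norm X *\<^sub>R id_blinfun + X) \<ge> 0"
  proof (rule tr_nonneg)
    show "positive_op (norm X *\<^sub>R id_blinfun + X)"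
      using assms(2) bounds(2) by (simp add: positive_op_iff hermitian_op_closed
          blinfun.bilinear_simps inner_add_left power2_norm_eq_inner)
  qed (intro vN_add[OF R] vN_scaleR[OF R] vN_id[OF R] assms(1))
  ultimately show ?thesis
    by (simp add: tr_diff tr_add tr_scaleR tr_id assms vN_scaleR[OF R] vN_id[OF R])
qed

text \<open>The product need not be hermitian, so \<open>tr_le_norm\<close> is applied to its
  symmetrization J, which has the same trace by traciality.\<close>

lemma tr_mult_le:
  assumes "X \<in> R" "Y \<in> R" "hermitian_op X" "hermitian_op Y"
  shows "\<bar>tr (X o\<^sub>L Y)\<bar> \<le> norm X * norm Y"
proof -
  define J where "J = (1 / 2) *\<^sub>R ((X o\<^sub>L Y) + (Y o\<^sub>L X))"
  have "J \<in> clinear_ops"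
    unfolding J_def using assms by (intro clinear_ops_closed hermitian_op_clinear)
  moreover have "inner (J x) y = inner x (J y)" for x y
    using assms by (simp add: J_def blinfun.bilinear_simps inner_add_left inner_add_right hermitian_op_inner)
  ultimately have "hermitian_op J"
    by (simp add: hermitian_op_def)
  have JR: "J \<in> R"
    unfolding J_def using assms by (intro vN_add[OF R] vN_scaleR[OF R] vN_compose[OF R])
  have "tr J = tr (X o\<^sub>L Y)"
    unfolding J_def using assms tr_commute[of Y X]
    by (simp add: tr_scaleR tr_add vN_compose[OF R] vN_add[OF R])
  moreover have "\<bar>tr J\<bar> \<le> norm J"
    using JR \<open>hermitian_op J\<close> by (rule tr_le_norm)
  moreover have "norm J \<le> norm X * norm Y"
  proof -
    have "norm J \<le> 1 / 2 * (norm (X o\<^sub>L Y) + norm (Y o\<^sub>L X))"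
      unfolding J_def norm_scaleR by (simp add: norm_triangle_ineq)
    also have "\<dots> \<le> norm X * norm Y"
      using norm_blinfun_compose[of X Y] norm_blinfun_compose[of Y X] by (simp add: mult.commute)
    finally show ?thesis .
  qed
  ultimately show ?thesis
    by simp
qed

lemma tr_mult_LIMSEQ:
  assumes C: "C \<in> R" "hermitian_op C" and D: "\<And>n. D n \<in> R" "\<And>n. hermitian_op (D n)" and lim: "D \<longlonglongrightarrow> L"
  shows "(\<lambda>n. tr (C o\<^sub>L D n)) \<longlonglongrightarrow> tr (C o\<^sub>L L)"
proof -
  have L: "L \<in> R" "hermitian_op L"
    using closed_sequentially[OF vN_closed[OF R] D(1) lim] hermitian_op_LIMSEQ[OF D(2) lim] by blast+
  have bound: "norm (tr (C o\<^sub>L D n) - tr (C o\<^sub>L L)) \<le> norm C * norm (D n - L)" for n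
    using tr_mult_le[of C "D n - L"] C D L
    by (simp add: vN_diff[OF R] hermitian_op_diff blinfun_compose_minus_right tr_diff vN_compose[OF R])
  have "(\<lambda>n. norm C * norm (D n - L)) \<longlonglongrightarrow> norm C * norm (L - L)"
    by (intro tendsto_intros lim)
  then have null: "(\<lambda>n. norm C * norm (D n - L)) \<longlonglongrightarrow> 0"
    by simp
  have "(\<lambda>n. tr (C o\<^sub>L D n) - tr (C o\<^sub>L L)) \<longlonglongrightarrow> 0"
    by (rule Lim_null_comparison[OF always_eventually[OF allI] null]) (rule bound)
  then show ?thesis
    by (rule LIM_zero_cancel)
qed

lemma tr_LIMSEQ:
  assumes "\<And>n. D n \<in> R" "\<And>n. hermitian_op (D n)" "D \<longlonglongrightarrow> L"
  shows "(\<lambda>n. tr (D n)) \<longlonglongrightarrow> tr L"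
  using tr_mult_LIMSEQ[OF vN_id[OF R] hermitian_op_id assms] by simp

lemma expectation_in: "X \<in> R \<Longrightarrow> \<Phi> X \<in> S"
  using expectation by (auto simp: conditional_expectation_def)

lemma expectation_module: "X \<in> R \<Longrightarrow> D \<in> S \<Longrightarrow> E \<in> S \<Longrightarrow> \<Phi> (D o\<^sub>L X o\<^sub>L E) = D o\<^sub>L \<Phi> X o\<^sub>L E"
  using expectation by (simp add: conditional_expectation_def)

lemma expectation_id: "\<Phi> id_blinfun = id_blinfun"
  using expectation by (simp add: conditional_expectation_def)

lemma expectation_on_S:
  assumes "X \<in> S"
  shows "\<Phi> X = X"
  using expectation_module[OF vN_id[OF R] assms vN_id[OF S]] by (simp add: expectation_id)

text \<open>The module property with \<open>id_blinfun\<close> on the left, followed by invariance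
  of \<tau>. It makes \<Phi> the orthogonal projection for the trace inner product.\<close>

lemma tr_expectation_mult:
  assumes "X \<in> R" "D \<in> S"
  shows "tr (X o\<^sub>L D) = tr (\<Phi> X o\<^sub>L D)"
proof -
  have "X o\<^sub>L D \<in> R"
    using assms S_sub_R by (intro vN_compose[OF R]) auto
  then show ?thesis
    using expectation_module[OF assms(1) vN_id[OF S] assms(2)] preserving[of "X o\<^sub>L D"] by simp
qed

text \<open>Positivity and unitality transport both bounds. Compatibility with adjoints is not part
  of \<open>conditional_expectation\<close>; that \<open>\<Phi> A\<close> is hermitian comes out of
  the positivity of its translate.\<close>

lemma expectation_between:
  assumes A: "A \<in> R" and "op_between m M A"
  shows "op_between m M (\<Phi> A)"
proof -
  have add: "\<Phi> (X + Y) = \<Phi> X + \<Phi> Y" if "X \<in> R" "Y \<in> R" for X Y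
    using expectation that by (simp add: conditional_expectation_def)
  have scale: "\<Phi> (r *\<^sub>R X) = r *\<^sub>R \<Phi> X" if "X \<in> R" for r X
    using expectation that by (simp add: conditional_expectation_def flip: scalar_op_of_real_compose)
  have pos: "positive_op (\<Phi> X)" if "X \<in> R" "positive_op X" for X
    using expectation that by (simp add: conditional_expectation_def)
  have "positive_op (A + (- m) *\<^sub>R id_blinfun)" "positive_op (M *\<^sub>R id_blinfun + (- 1) *\<^sub>R A)"
    using assms(2) by (simp_all add: op_between_def positive_op_iff hermitian_op_closed
        blinfun.bilinear_simps inner_diff_left flip: power2_norm_eq_inner)
  moreover have "A + (- m) *\<^sub>R id_blinfun \<in> R" "M *\<^sub>R id_blinfun + (- 1) *\<^sub>R A \<in> R"
    by (intro vN_add[OF R] vN_scaleR[OF R] vN_id[OF R] A)+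
  ultimately have "positive_op (\<Phi> (A + (- m) *\<^sub>R id_blinfun))" "positive_op (\<Phi> (M *\<^sub>R id_blinfun + (- 1) *\<^sub>R A))"
    by (blast intro: pos)+
  then have p: "positive_op (\<Phi> A + (- m) *\<^sub>R id_blinfun)" "positive_op (M *\<^sub>R id_blinfun + (- 1) *\<^sub>R \<Phi> A)"
    by (simp_all only: add scale expectation_id A vN_id[OF R] vN_scaleR[OF R])
  have "hermitian_op (\<Phi> A + (- m) *\<^sub>R id_blinfun)"
    using p(1) by (simp only: positive_op_iff)
  from hermitian_op_add[OF this hermitian_op_scaleR[OF hermitian_op_id, of m]]
  have "hermitian_op (\<Phi> A)"
    by simp
  then show ?thesis
    using p by (simp add: op_between_def positive_op_iff blinfun.bilinear_simps inner_diff_left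
        flip: power2_norm_eq_inner)
qed

text \<open>
  For fixed \<open>t\<close> the hypothesis makes \<open>\<phi>(A) + \<psi>(t) A + \<omega>(t)\<close> a positive operator. Pairing it, at the
  nodes \<open>t = t\<^sub>k\<close>, with the partition of unity given by the Bernstein polynomials in \<open>\<Phi> A\<close> and summing
  yields Bernstein approximations of \<open>\<psi>\<close> and \<open>\<omega>\<close> at \<open>\<Phi> A\<close>.
\<close>

lemma Klein_inequality:
  assumes A: "A \<in> R" and mM: "m < M" and between: "op_between m M A"
    and \<phi>: "continuous_on {m..M} \<phi>" and \<psi>: "continuous_on {m..M} \<psi>" and \<omega>: "continuous_on {m..M} \<omega>"
    and nonneg: "\<And>s t. s \<in> {m..M} \<Longrightarrow> t \<in> {m..M} \<Longrightarrow> \<phi> s + s * \<psi> t + \<omega> t \<ge> 0"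
  shows "0 \<le> tr (cfc \<phi> A) + tr (cfc (\<lambda>t. t * \<psi> t + \<omega> t) (\<Phi> A))"
proof -
  define B where "B = \<Phi> A"
  have B: "B \<in> S" "B \<in> R"
    using expectation_in[OF A] S_sub_R by (auto simp: B_def)
  interpret A: op_interval m M A
    using mM between by unfold_locales
  interpret B: op_interval m M B
    using mM expectation_between[OF A between] by unfold_locales (simp_all add: B_def)
  define node where "node n k = m + (M - m) * (real k / real n)" for n k
  \<comment> \<open>Division by 0 yields 0, so for \<open>n = 0\<close> the only node is
    \<open>m\<close>, which lies in the interval as well.\<close>
  have node: "node n k \<in> {m..M}" if "k \<le> n" for n k
  proof -
    have "(M - m) * (real k / real n) \<le> M - m"
      by (rule mult_left_le) (use that mM in \<open>auto simp: divide_le_eq_1\<close>)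
    moreover have "0 \<le> (M - m) * (real k / real n)"
      using mM by simp
    ultimately show ?thesis
      unfolding node_def atLeastAtMost_iff by linarith
  qed
  define v where "v n k = poly_op (bernstein_poly m M n k) B" for n k
  define P where "P g n = (\<Sum>k\<le>n. smult (g (node n k)) (bernstein_poly m M n k))" for g :: "real \<Rightarrow> real" and n
  have vR: "v n k \<in> R" for n k
    unfolding v_def by (rule vN_poly_op[OF R B(2)])
  have P_lim: "(\<lambda>n. poly_op (P g n) B) \<longlonglongrightarrow> cfc g B" if "continuous_on {m..M} g" for g
    unfolding P_def node_def by (rule B.cfc_LIMSEQ[OF uniform_limit_bernstein[OF mM that]])
  have P_op: "poly_op (P g n) B = (\<Sum>k\<le>n. g (node n k) *\<^sub>R v n k)" for g n
    by (simp add: P_def v_def poly_op_sum poly_op_smult)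
  have id: "id_blinfun = (\<Sum>k\<le>n. v n k)" for n
    unfolding v_def poly_op_sum[symmetric] sum_bernstein_poly poly_op_1 ..
  have tr_P: "tr (X o\<^sub>L poly_op (P g n) B) = (\<Sum>k\<le>n. g (node n k) * tr (X o\<^sub>L v n k))" if "X \<in> R" for X g n
    unfolding P_op bounded_bilinear.sum_right[OF bounded_bilinear_blinfun_compose]
    using tr_sum[of "{..n}" "\<lambda>k. X o\<^sub>L g (node n k) *\<^sub>R v n k"] that vR
    by (simp add: vN_compose[OF R] vN_scaleR[OF R] blinfun_compose_scaleR_right tr_scaleR)
  have \<phi>A: "cfc \<phi> A \<in> R"
    by (rule A.vN_cfc[OF R A \<phi>])
  have "0 \<le> tr (cfc \<phi> A) + tr (B o\<^sub>L poly_op (P \<psi> n) B) + tr (poly_op (P \<omega> n) B)" for n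
  proof -
    have "0 \<le> tr (cfc \<phi> A o\<^sub>L v n k) + \<psi> (node n k) * tr (A o\<^sub>L v n k) + \<omega> (node n k) * tr (id_blinfun o\<^sub>L v n k)"
      if "k \<le> n" for k
    proof -
      define t where "t = node n k"
      define X where "X = cfc (\<lambda>s. \<phi> s + \<psi> t * s + \<omega> t) A"
      \<comment> \<open>A square root of the k-th weight: \<open>tr_mult_square_nonneg\<close> pairs
        the positive \<open>X\<close> with a square.\<close>
      define Y where "Y = cfc (\<lambda>t. sqrt (poly (bernstein_poly m M n k) t)) B"
      have X: "X = cfc \<phi> A + \<psi> t *\<^sub>R A + \<omega> t *\<^sub>R id_blinfun"
        by (simp add: X_def A.cfc_add A.cfc_cmult A.cfc_ident A.cfc_const \<phi> continuous_intros)
      have "v n k = Y o\<^sub>L Y"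
        unfolding Y_def v_def B.cfc_poly[symmetric]
        by (intro B.cfc_square_root[symmetric] continuous_intros bernstein_poly_nonneg mM)
      moreover have "positive_op X"
        unfolding X_def using nonneg[OF _ node[OF that]]
        by (intro A.cfc_nonneg continuous_intros \<phi>) (simp add: t_def mult.commute)
      moreover have "X \<in> R" "Y \<in> R" "hermitian_op Y"
        unfolding X_def Y_def
        by (intro A.vN_cfc[OF R A] B.vN_cfc[OF R B(2)] B.cfc_hermitian continuous_intros \<phi>)+
      ultimately have "0 \<le> tr (X o\<^sub>L v n k)"
        using tr_mult_square_nonneg by simp
      also have "tr (X o\<^sub>L v n k) = tr (cfc \<phi> A o\<^sub>L v n k) + \<psi> t * tr (A o\<^sub>L v n k) + \<omega> t * tr (id_blinfun o\<^sub>L v n k)"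
        unfolding X using \<phi>A A vR vN_id[OF R]
        by (simp add: blinfun_compose_plus_left blinfun_compose_scaleR_left tr_add tr_scaleR
            vN_add[OF R] vN_scaleR[OF R] vN_compose[OF R])
      finally show ?thesis
        by (simp add: t_def)
    qed
    then have "0 \<le> (\<Sum>k\<le>n. tr (cfc \<phi> A o\<^sub>L v n k) + \<psi> (node n k) * tr (A o\<^sub>L v n k)
        + \<omega> (node n k) * tr (id_blinfun o\<^sub>L v n k))"
      by (intro sum_nonneg) simp
    also have "\<dots> = tr (cfc \<phi> A o\<^sub>L poly_op (P (\<lambda>_. 1) n) B) + tr (A o\<^sub>L poly_op (P \<psi> n) B)
        + tr (id_blinfun o\<^sub>L poly_op (P \<omega> n) B)"
      by (simp only: sum.distrib tr_P[OF A] tr_P[OF vN_id[OF R]] tr_P[OF \<phi>A] mult_1_left)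
    \<comment> \<open>The weights sum to 1, so the \<phi> term is exact and only the terms with
      \<psi> and \<omega> need a limit.\<close>
    also have "poly_op (P (\<lambda>_. 1) n) B = id_blinfun"
      using id[of n] by (simp add: P_op)
    \<comment> \<open>A polynomial in B lies in S, so here A may be replaced by B under the
      trace.\<close>
    also have "tr (A o\<^sub>L poly_op (P \<psi> n) B) = tr (B o\<^sub>L poly_op (P \<psi> n) B)"
      unfolding B_def by (intro tr_expectation_mult A vN_poly_op[OF S] expectation_in)
    finally show ?thesis
      by simp
  qed
  moreover have "(\<lambda>n. tr (cfc \<phi> A) + tr (B o\<^sub>L poly_op (P \<psi> n) B) + tr (poly_op (P \<omega> n) B))
      \<longlonglongrightarrow> tr (cfc \<phi> A) + tr (B o\<^sub>L cfc \<psi> B) + tr (cfc \<omega> B)"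
    by (intro tendsto_add tendsto_const tr_mult_LIMSEQ tr_LIMSEQ P_lim B B.hermitian hermitian_op_poly
        vN_poly_op[OF R] \<psi> \<omega>)
  ultimately have "0 \<le> tr (cfc \<phi> A) + tr (B o\<^sub>L cfc \<psi> B) + tr (cfc \<omega> B)"
    by (intro LIMSEQ_le_const) auto
  moreover have "tr (B o\<^sub>L cfc \<psi> B) + tr (cfc \<omega> B) = tr (cfc (\<lambda>t. t * \<psi> t + \<omega> t) B)"
    using B B.vN_cfc[OF R B(2)] \<psi> \<omega>
    by (simp add: B.cfc_add B.cfc_mult B.cfc_ident tr_add vN_compose[OF R] continuous_intros)
  ultimately show ?thesis
    by (simp add: B_def add.assoc)
qed

end

text \<open>For s outside the open interval between t and t + \<epsilon>, one of these two nodes is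
  a convex combination of s and the other, and concavity there puts g s below the secant. Small
  \<epsilon> gives approximate supergradients; long steps serve to compare slopes of f.\<close>

lemma concave_on_forward_difference:
  fixes g :: "real \<Rightarrow> real"
  assumes g: "concave_on I g" and "t \<in> I" "t + \<epsilon> \<in> I" "s \<in> I" "\<epsilon> > 0" and s: "s \<le> t \<or> t + \<epsilon> \<le> s"
  shows "g s \<le> g t + (s - t) * ((g (t + \<epsilon>) - g t) / \<epsilon>)"
proof (cases "s \<le> t")
  case True
  define u where "u = (t - s) / (t + \<epsilon> - s)"
  have ud: "u * (t + \<epsilon> - s) = t - s"
    using True \<open>\<epsilon> > 0\<close> by (simp add: u_def)
  then have "(1 - u) *\<^sub>R s + u *\<^sub>R (t + \<epsilon>) = t"
    by (simp add: algebra_simps)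
  moreover have "0 \<le> u" "u \<le> 1"
    using True \<open>\<epsilon> > 0\<close> by (simp_all add: u_def)
  ultimately have u: "0 \<le> u" "u \<le> 1" "(1 - u) *\<^sub>R s + u *\<^sub>R (t + \<epsilon>) = t"
    by blast+
  have "(1 - u) * g s + u * g (t + \<epsilon>) \<le> g t"
    using concave_onD[OF g u(1,2) \<open>s \<in> I\<close> \<open>t + \<epsilon> \<in> I\<close>] unfolding u(3) .
  then have "((1 - u) * g s + u * g (t + \<epsilon>)) * (t + \<epsilon> - s) \<le> g t * (t + \<epsilon> - s)"
    using True \<open>\<epsilon> > 0\<close> by (intro mult_right_mono) auto
  also have "((1 - u) * g s + u * g (t + \<epsilon>)) * (t + \<epsilon> - s)
      = g s * (t + \<epsilon> - s) + u * (t + \<epsilon> - s) * (g (t + \<epsilon>) - g s)"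
    by (simp add: algebra_simps)
  finally have "\<epsilon> * g s + (t - s) * g (t + \<epsilon>) \<le> g t * (t + \<epsilon> - s)"
    unfolding ud by (simp add: algebra_simps)
  then show ?thesis
    using \<open>\<epsilon> > 0\<close> by (simp add: field_simps)
next
  case False
  then have "t + \<epsilon> \<le> s"
    using s by simp
  define u where "u = \<epsilon> / (s - t)"
  have ud: "u * (s - t) = \<epsilon>"
    using False by (simp add: u_def)
  then have "(1 - u) *\<^sub>R t + u *\<^sub>R s = t + \<epsilon>"
    by (simp add: algebra_simps)
  moreover have "0 \<le> u" "u \<le> 1"
    using False \<open>t + \<epsilon> \<le> s\<close> \<open>\<epsilon> > 0\<close> by (simp_all add: u_def)
  ultimately have u: "0 \<le> u" "u \<le> 1" "(1 - u) *\<^sub>R t + u *\<^sub>R s = t + \<epsilon>"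
    by blast+
  have "(1 - u) * g t + u * g s \<le> g (t + \<epsilon>)"
    using concave_onD[OF g u(1,2) \<open>t \<in> I\<close> \<open>s \<in> I\<close>] unfolding u(3) .
  then have "((1 - u) * g t + u * g s) * (s - t) \<le> g (t + \<epsilon>) * (s - t)"
    using False by (intro mult_right_mono) auto
  also have "((1 - u) * g t + u * g s) * (s - t) = g t * (s - t) + u * (s - t) * (g s - g t)"
    by (simp add: algebra_simps)
  finally have "\<epsilon> * g s \<le> \<epsilon> * g t + (s - t) * (g (t + \<epsilon>) - g t)"
    unfolding ud by (simp add: algebra_simps)
  then show ?thesis
    using \<open>\<epsilon> > 0\<close> by (simp add: field_simps)
qed

section \<open>The trace Jensen inequality and its strong form\<close>

context trace_preserving_expectation
begin

text \<open>
  The interval is enlarged to the right so that the forward difference quotients, which serve as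
  continuous approximate supergradients, are defined.
\<close>

lemma trace_Jensen:
  assumes A: "A \<in> R" and mM: "m < M" and between: "op_between m M A"
    and cont: "continuous_on {m..M + 1} g" and concave: "concave_on {m..M + 1} g"
  shows "tr (cfc g A) \<le> tr (cfc g (\<Phi> A))"
proof (rule field_le_epsilon)
  fix e :: real
  assume e: "e > 0"
  have "uniformly_continuous_on {m..M + 1} g"
    using cont by (rule compact_uniformly_continuous) simp
  then obtain d where d: "d > 0"
    "\<And>s t. s \<in> {m..M + 1} \<Longrightarrow> t \<in> {m..M + 1} \<Longrightarrow> dist t s < d \<Longrightarrow> dist (g t) (g s) < e / 2"
    using e unfolding uniformly_continuous_on_def by (metis half_gt_zero)
  define \<epsilon> where "\<epsilon> = min 1 (d / 2)"
  have \<epsilon>: "0 < \<epsilon>" "\<epsilon> \<le> 1" "\<epsilon> < d"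
    using d by (auto simp: \<epsilon>_def)
  define \<psi> where "\<psi> t = (g (t + \<epsilon>) - g t) / \<epsilon>" for t
  have supergradient: "g s \<le> g t + (s - t) * \<psi> t + e" if st: "s \<in> {m..M}" "t \<in> {m..M}" for s t
  proof (cases "s \<le> t \<or> t + \<epsilon> \<le> s")
    case True
    then show ?thesis
      using concave_on_forward_difference[OF concave _ _ _ _ True] st \<epsilon> e by (simp add: \<psi>_def)
  next
    case False
    \<comment> \<open>For s strictly between t and t + \<epsilon> the graph may exceed the secant.
      By uniform continuity g s and g (t + \<epsilon>) are within e / 2 of g t, and the secant term
      is no larger than the second difference, so the excess is below e.\<close>
    then have "dist s t < d" "dist (t + \<epsilon>) t < d"
      using \<epsilon> by (auto simp: dist_real_def)
    then have "\<bar>g s - g t\<bar> < e / 2" "\<bar>g (t + \<epsilon>) - g t\<bar> < e / 2"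
      using d(2)[of t s] d(2)[of t "t + \<epsilon>"] st \<epsilon> by (auto simp: dist_real_def)
    moreover have "\<bar>(s - t) * \<psi> t\<bar> \<le> \<bar>g (t + \<epsilon>) - g t\<bar>"
    proof -
      have "\<bar>(s - t) * \<psi> t\<bar> = (\<bar>s - t\<bar> / \<epsilon>) * \<bar>g (t + \<epsilon>) - g t\<bar>"
        using \<epsilon> by (simp add: \<psi>_def abs_mult)
      also have "\<dots> \<le> 1 * \<bar>g (t + \<epsilon>) - g t\<bar>"
        using False \<epsilon> by (intro mult_right_mono) auto
      finally show ?thesis
        by simp
    qed
    ultimately show ?thesis
      by linarith
  qed
  have g: "continuous_on {m..M} g"
    by (rule continuous_on_subset[OF cont]) auto
  have g_shift: "continuous_on {m..M} (\<lambda>t. g (t + \<epsilon>))"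
    by (rule continuous_on_compose2[OF cont]) (use \<epsilon> in \<open>auto intro!: continuous_intros\<close>)
  have \<psi>: "continuous_on {m..M} \<psi>"
    unfolding \<psi>_def using \<epsilon> by (intro continuous_intros g g_shift) auto
  \<comment> \<open>With \<phi> = - g and \<omega> t = g t - t \<psi> t + e, the hypothesis of
    \<open>Klein_inequality\<close> is \<open>supergradient\<close>, and the function of
    \<open>\<Phi> A\<close> collapses to g + e.\<close>
  have "0 \<le> tr (cfc (\<lambda>s. - 1 * g s) A) + tr (cfc (\<lambda>t. t * \<psi> t + (g t - t * \<psi> t + e)) (\<Phi> A))"
  proof (rule Klein_inequality[OF A mM between])
    show "0 \<le> - 1 * g s + s * \<psi> t + (g t - t * \<psi> t + e)" if "s \<in> {m..M}" "t \<in> {m..M}" for s t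
      using supergradient[OF that] by (simp add: algebra_simps)
  qed (intro continuous_intros g \<psi>)+
  moreover interpret A: op_interval m M A
    using mM between by unfold_locales
  interpret B: op_interval m M "\<Phi> A"
    using mM expectation_between[OF A between] by unfold_locales
  have B: "\<Phi> A \<in> R"
    using expectation_in[OF A] S_sub_R by auto
  have "tr (cfc (\<lambda>s. - 1 * g s) A) = - tr (cfc g A)"
    unfolding A.cfc_cmult[OF g] tr_scaleR[OF A.vN_cfc[OF R A g]] by simp
  moreover have "(\<lambda>t. t * \<psi> t + (g t - t * \<psi> t + e)) = (\<lambda>t. g t + e)"
    by auto
  moreover have "tr (cfc (\<lambda>t. g t + e) (\<Phi> A)) = tr (cfc g (\<Phi> A)) + e"
    using B.vN_cfc[OF R B g]
    by (simp add: B.cfc_add g B.cfc_const continuous_intros tr_add tr_scaleR vN_scaleR[OF R] vN_id[OF R] tr_id)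
  ultimately show "tr (cfc g A) \<le> tr (cfc g (\<Phi> A)) + e"
    by simp
qed

lemma trace_Jensen_strong:
  assumes A: "A \<in> R" and mM: "m < M" and between: "op_between m M A"
    and cont: "continuous_on {m..M + 1} g" and concave: "concave_on {m..M + 1} (\<lambda>t. g t + c * t\<^sup>2)"
  shows "tr (cfc g A) + c * tr ((A - \<Phi> A) o\<^sub>L (A - \<Phi> A)) \<le> tr (cfc g (\<Phi> A))"
proof -
  define B where "B = \<Phi> A"
  have B: "B \<in> S" "B \<in> R"
    using expectation_in[OF A] S_sub_R by (auto simp: B_def)
  have g: "continuous_on {m..M} g"
    by (rule continuous_on_subset[OF cont]) auto
  have split: "tr (cfc (\<lambda>t. g t + c * t\<^sup>2) X) = tr (cfc g X) + c * tr (X o\<^sub>L X)"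
    if "op_interval m M X" "X \<in> R" for X
  proof -
    interpret op_interval m M X by (fact that(1))
    show ?thesis
      using vN_cfc[OF R that(2) g] that(2)
      by (simp add: power2_eq_square cfc_add cfc_cmult cfc_mult cfc_ident g continuous_intros tr_add
          tr_scaleR vN_scaleR[OF R] vN_compose[OF R])
  qed
  have "tr (cfc (\<lambda>t. g t + c * t\<^sup>2) A) \<le> tr (cfc (\<lambda>t. g t + c * t\<^sup>2) B)"
    unfolding B_def by (intro trace_Jensen[OF A mM between _ concave] continuous_intros cont)
  then have "tr (cfc g A) + c * tr (A o\<^sub>L A) \<le> tr (cfc g B) + c * tr (B o\<^sub>L B)"
    using split[of A] split[of B] A B mM between expectation_between[OF A between]
    by (simp add: op_interval_def B_def)
  \<comment> \<open>Both cross terms of (A - B)^2 therefore have the trace of B^2: Pythagoras for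
    the projection \<Phi>.\<close>
  moreover have "tr (A o\<^sub>L B) = tr (B o\<^sub>L B)"
    using tr_expectation_mult[OF A B(1)] by (simp add: B_def)
  then have "tr ((A - B) o\<^sub>L (A - B)) = tr (A o\<^sub>L A) - tr (B o\<^sub>L B)"
    using tr_commute[OF B(2) A] A B
    by (simp add: blinfun_compose_distribs tr_diff vN_diff[OF R] vN_compose[OF R])
  then have "c * tr ((A - B) o\<^sub>L (A - B)) = c * tr (A o\<^sub>L A) - c * tr (B o\<^sub>L B)"
    by (simp only: right_diff_distrib)
  ultimately show ?thesis
    unfolding B_def by linarith
qed

text \<open>Faithfulness speaks of the complex value of \<tau>; positivity of the square makes this
  value real, so its real part decides.\<close>

lemma tr_square_eq_0:
  assumes "D \<in> R" "hermitian_op D" "tr (D o\<^sub>L D) = 0"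
  shows "D = 0"
proof -
  have "\<tau> (D o\<^sub>L D) \<in> \<real>\<^sub>\<ge>\<^sub>0"
    using state positive_op_square[OF assms(2)] vN_compose[OF R assms(1) assms(1)]
    by (simp add: state_on_def)
  then have "\<tau> (cadjoint D o\<^sub>L D) = 0"
    using assms(3) by (simp add: hermitian_op_cadjoint[OF assms(2)] complex_nonneg_Reals_iff complex_eq_iff)
  then show ?thesis
    using faithful assms(1) by (simp add: faithful_on_def)
qed

end

section \<open>Scalar consequences of operator monotonicity\<close>

lemma norm_cinner_le: "cmod (cinner x y) \<le> norm x * norm (y::'a::complex_hilbert)"
proof (cases "cinner x y = 0")
  case False
  \<comment> \<open>The phase that rotates \<open>cinner x y\<close> onto its modulus, which reduces
    the claim to the real Cauchy-Schwarz inequality.\<close>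
  define c where "c = cnj (sgn (cinner x y))"
  have "c * cinner x y = (cinner x y * cnj (cinner x y)) / of_real (cmod (cinner x y))"
    by (simp add: c_def sgn_eq)
  also have "\<dots> = of_real (cmod (cinner x y))"
    using False by (simp add: power2_eq_square flip: complex_norm_square)
  finally have "cmod (cinner x y) = Re (c * cinner x y)"
    by simp
  also have "\<dots> = inner (c *\<^sub>C x) y"
    by (simp add: cinner_scaleC_left flip: Re_cinner)
  also have "\<dots> \<le> norm (c *\<^sub>C x) * norm y"
    by (rule norm_cauchy_schwarz)
  also have "norm (c *\<^sub>C x) = norm x"
    using False by (simp add: norm_scaleC c_def norm_sgn)
  finally show ?thesis .
qed simp

text \<open>For a unit vector \<open>v\<close>, the orthogonal projection onto the complex line
  through \<open>v\<close>.\<close>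

lift_definition vector_proj :: "'a::complex_hilbert \<Rightarrow> 'a \<Rightarrow>\<^sub>L 'a" is "\<lambda>v x. cinner x v *\<^sub>C v"
proof (rule bounded_linear_intro)
  fix v x y :: 'a and r :: real
  show "cinner (x + y) v *\<^sub>C v = cinner x v *\<^sub>C v + cinner y v *\<^sub>C v"
    by (simp add: cinner_add_left scaleC_add_left)
  show "cinner (r *\<^sub>R x) v *\<^sub>C v = r *\<^sub>R (cinner x v *\<^sub>C v)"
    by (simp only: cinner_scaleR_left scaleC_of_real flip: scaleC_scaleC)
  show "norm (cinner x v *\<^sub>C v) \<le> norm x * (norm v * norm v)"
    using mult_right_mono[OF norm_cinner_le[of x v], of "norm v"] by (simp add: norm_scaleC mult.assoc)
qed

lemma hermitian_op_vector_proj: "hermitian_op (vector_proj v)"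
proof -
  have "inner (vector_proj v x) y = inner x (vector_proj v y)" for x y
  proof -
    have "cinner v y = cnj (cinner y v)"
      by (rule cinner_commute)
    then show ?thesis
      by (simp add: vector_proj.rep_eq cinner_scaleC_left cinner_scaleC_right mult.commute flip: Re_cinner)
  qed
  moreover have "vector_proj v \<in> clinear_ops"
    by (simp add: clinear_ops_def vector_proj.rep_eq cinner_scaleC_left scaleC_scaleC)
  ultimately show ?thesis
    by (simp add: hermitian_op_def)
qed

lemma vector_proj_idem:
  assumes "norm v = 1"
  shows "vector_proj v o\<^sub>L vector_proj v = vector_proj v"
  by (rule blinfun_eqI) (simp add: vector_proj.rep_eq cinner_scaleC_left cinner_self assms)

lemma inner_vector_proj: "inner (vector_proj v x) x = (cmod (cinner x v))\<^sup>2"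
proof -
  have "cinner v x = cnj (cinner x v)"
    by (rule cinner_commute)
  then show ?thesis
    by (simp add: vector_proj.rep_eq cinner_scaleC_left complex_mult_cnj flip: Re_cinner cmod_power2)
qed

text \<open>For a projection P, the eigenvalue is a on its range and b on its kernel. With P of rank
  one these operators play the part of 2x2 matrices on a large space, and a continuous function
  simply acts on a and b.\<close>

definition two_point_op :: "real \<Rightarrow> real \<Rightarrow> ('h::complex_hilbert \<Rightarrow>\<^sub>L 'h) \<Rightarrow> 'h \<Rightarrow>\<^sub>L 'h" where
  "two_point_op a b P = a *\<^sub>R P + b *\<^sub>R (id_blinfun - P)"

lemma poly_op_two_point:
  assumes "P o\<^sub>L P = P"
  shows "poly_op p (two_point_op a b P) = two_point_op (poly p a) (poly p b) P"
proof (induction p)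
  case 0
  show ?case
    by (simp add: two_point_op_def)
next
  case (pCons c p)
  show ?case
    by (simp add: poly_op_pCons pCons.IH) (simp add: two_point_op_def blinfun_compose_distribs assms algebra_simps)
qed

lemma inner_two_point_op:
  "inner (two_point_op a b P x) x = a * inner (P x) x + b * ((norm x)\<^sup>2 - inner (P x) x)"
  by (simp add: two_point_op_def blinfun.bilinear_simps inner_add_left inner_diff_left power2_norm_eq_inner)

lemma two_point_op_interval:
  assumes P: "hermitian_op P" "P o\<^sub>L P = P" and "m < M" "a \<in> {m..M}" "b \<in> {m..M}"
  shows "op_interval m M (two_point_op a b P)"
proof
  have range: "0 \<le> inner (P x) x" "inner (P x) x \<le> (norm x)\<^sup>2" for x
  proof -
    have "inner (P x) x = inner (P (P x)) x"
      by (metis P(2) blinfun_apply_blinfun_compose)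
    then have eq: "inner (P x) x = (norm (P x))\<^sup>2"
      by (simp add: hermitian_op_inner[OF P(1), of "P x"] power2_norm_eq_inner)
    then show "0 \<le> inner (P x) x"
      by simp
    have "0 \<le> (norm (P x - x))\<^sup>2"
      by simp
    then show "inner (P x) x \<le> (norm x)\<^sup>2"
      unfolding power2_norm_diff using eq by simp
  qed
  show "op_between m M (two_point_op a b P)"
    unfolding op_between_def
  proof (intro conjI allI)
    show "hermitian_op (two_point_op a b P)"
      unfolding two_point_op_def by (intro hermitian_op_closed P)
    fix x
    define r where "r = inner (P x) x"
    define n where "n = (norm x)\<^sup>2"
    have r: "0 \<le> r" "0 \<le> n - r"
      using range[of x] by (simp_all add: r_def n_def)
    have "m * r \<le> a * r" "a * r \<le> M * r" "m * (n - r) \<le> b * (n - r)" "b * (n - r) \<le> M * (n - r)"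
      using assms(4,5) r by (auto intro: mult_right_mono)
    then show "m * (norm x)\<^sup>2 \<le> inner (two_point_op a b P x) x"
      "inner (two_point_op a b P x) x \<le> M * (norm x)\<^sup>2"
      unfolding inner_two_point_op r_def[symmetric] n_def[symmetric] by (simp_all add: algebra_simps)
  qed
qed (fact assms(3))

lemma cfc_two_point_op:
  assumes P: "hermitian_op P" "P o\<^sub>L P = P" and "m < M" "a \<in> {m..M}" "b \<in> {m..M}"
    and f: "continuous_on {m..M} f"
  shows "cfc f (two_point_op a b P) = two_point_op (f a) (f b) P"
proof -
  interpret op_interval m M "two_point_op a b P"
    using assms(1-5) by (rule two_point_op_interval)
  obtain p where p: "uniform_limit {m..M} (\<lambda>n. poly (p n)) f sequentially"
    "(\<lambda>n. poly_op (p n) (two_point_op a b P)) \<longlonglongrightarrow> cfc f (two_point_op a b P)"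
    using cfc_approx[OF f] by blast
  have "(\<lambda>n. poly_op (p n) (two_point_op a b P)) \<longlonglongrightarrow> two_point_op (f a) (f b) P"
    unfolding poly_op_two_point[OF P(2)] unfolding two_point_op_def
    by (intro tendsto_intros tendsto_uniform_limitI[OF p(1)] assms)
  with p(2) show ?thesis
    by (rule LIMSEQ_unique)
qed

text \<open>The difference of the two sides is a square divided by \<alpha> \<beta>. With \<alpha> =
  p - b and \<beta> = q - b it compares a rank-one form with a diagonal one.\<close>

lemma weighted_Cauchy_Schwarz:
  fixes u r z w \<alpha> \<beta> :: real
  assumes "\<alpha> > 0" "\<beta> > 0"
  shows "(u * z + r * w)\<^sup>2 \<le> (u\<^sup>2 / \<alpha> + r\<^sup>2 / \<beta>) * (\<alpha> * z\<^sup>2 + \<beta> * w\<^sup>2)"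
proof -
  have "(u\<^sup>2 / \<alpha> + r\<^sup>2 / \<beta>) * (\<alpha> * z\<^sup>2 + \<beta> * w\<^sup>2) - (u * z + r * w)\<^sup>2
      = (u * \<beta> * w - r * \<alpha> * z)\<^sup>2 / (\<alpha> * \<beta>)"
    using assms by (simp add: field_simps power2_eq_square)
  also have "\<dots> \<ge> 0"
    using assms by simp
  finally show ?thesis
    by simp
qed

text \<open>
  The two inequalities are the diagonal entries at \<open>e\<close> and at \<open>v = \<surd>t e + \<surd>(1 - t) e'\<close> of
  \<open>f(X) \<le> f(Y)\<close>, where \<open>X\<close> has eigenvalue \<open>a\<close> at \<open>v\<close> and \<open>b\<close> elsewhere, and \<open>Y\<close> has eigenvalue \<open>p\<close> at \<open>e\<close>
  and \<open>q\<close> elsewhere. The last hypothesis ensures \<open>X \<le> Y\<close>.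
\<close>

lemma operator_monotone_two_point:
  fixes e e' :: "'k::complex_hilbert"
  assumes mono: "operator_monotone_on TYPE('k) {0<..} f"
    and e: "norm e = 1" "norm e' = 1" "cinner e e' = 0"
    and b: "0 < b" "b < p" "b < q" "b \<le> a" and t: "0 \<le> t" "t \<le> 1"
    and le: "(a - b) * (t / (p - b) + (1 - t) / (q - b)) \<le> 1"
  shows "t * f a + (1 - t) * f b \<le> f p" and "f a \<le> t * f p + (1 - t) * f q"
proof -
  define v where "v = sqrt t *\<^sub>R e + sqrt (1 - t) *\<^sub>R e'"
  have e'e: "cinner e' e = 0"
    using e(3) cinner_commute[of e' e] by simp
  have xv: "cinner x v = sqrt t *\<^sub>R cinner x e + sqrt (1 - t) *\<^sub>R cinner x e'" for x
    by (simp add: v_def cinner_add_right cinner_scaleR_right scaleR_conv_of_real)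
  have ev: "cinner e v = sqrt t"
    by (simp add: xv e cinner_self scaleR_conv_of_real)
  have "cinner v v = of_real (sqrt t * sqrt t + sqrt (1 - t) * sqrt (1 - t))"
    unfolding xv by (simp add: v_def cinner_add_left cinner_scaleR_left e e'e cinner_self scaleR_conv_of_real
        del: real_sqrt_mult_self)
  also have "\<dots> = 1"
    using t by simp
  finally have vv: "cinner v v = 1" .
  then have "(norm v)\<^sup>2 = 1"
    unfolding cinner_self of_real_eq_1_iff .
  then have v: "norm v = 1"
    using power2_eq_iff_nonneg[of "norm v" 1] by simp
  define X where "X = two_point_op a b (vector_proj v)"
  define Y where "Y = two_point_op p q (vector_proj e)"
  define M where "M = a + p + q"
  have M: "b < M" "a \<in> {b..M}" "b \<in> {b..M}" "p \<in> {b..M}" "q \<in> {b..M}"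
    using b by (auto simp: M_def)
  have cont: "continuous_on {b..M} f"
    using mono b(1) by (auto simp: operator_monotone_on_def intro: continuous_on_subset)
  note proj = hermitian_op_vector_proj vector_proj_idem
  interpret X: op_interval b M X
    unfolding X_def by (intro two_point_op_interval proj v M)
  interpret Y: op_interval b M Y
    unfolding Y_def by (intro two_point_op_interval proj e M)
  have "positive_op (Y - X)"
    unfolding positive_op_iff
  proof (intro conjI allI)
    show "hermitian_op (Y - X)"
      by (intro hermitian_op_diff X.hermitian Y.hermitian)
    fix x :: 'k
    define n where "n = (norm x)\<^sup>2"
    define E where "E = (cmod (cinner x e))\<^sup>2"
    define E' where "E' = (cmod (cinner x e'))\<^sup>2"
    define V where "V = (cmod (cinner x v))\<^sup>2"
    \<comment> \<open>Bessel's inequality for e and e'. With b subtracted from both operators, it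
      remains to bound (a - b) times the projection onto v by the part of Y - b carried by e and
      e'.\<close>
    have E'_le: "E' \<le> n - E"
    proof -
      have "cinner x e' = cinner (x - vector_proj e x) e'"
        by (simp add: cinner_diff_left vector_proj.rep_eq cinner_scaleC_left e)
      then have "cmod (cinner x e') \<le> norm (x - vector_proj e x)"
        using norm_cinner_le[of "x - vector_proj e x" e'] e by simp
      then have "E' \<le> (norm (x - vector_proj e x))\<^sup>2"
        unfolding E'_def by (intro power_mono) auto
      also have "\<dots> = n - 2 * E + (norm (vector_proj e x))\<^sup>2"
        by (simp add: power2_norm_diff n_def E_def inner_vector_proj inner_commute[of x])
      also have "(norm (vector_proj e x))\<^sup>2 = E"
        by (simp add: vector_proj.rep_eq norm_scaleC e E_def)
      finally show ?thesis
        by simp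
    qed
    have "V \<le> (t / (p - b) + (1 - t) / (q - b)) * ((p - b) * E + (q - b) * E')"
    proof -
      have "cmod (cinner x v) \<le> sqrt t * cmod (cinner x e) + sqrt (1 - t) * cmod (cinner x e')"
        unfolding xv using norm_triangle_ineq[of "sqrt t *\<^sub>R cinner x e" "sqrt (1 - t) *\<^sub>R cinner x e'"] t
        by simp
      then have "V \<le> (sqrt t * cmod (cinner x e) + sqrt (1 - t) * cmod (cinner x e'))\<^sup>2"
        unfolding V_def by (intro power_mono) auto
      also have "\<dots> \<le> ((sqrt t)\<^sup>2 / (p - b) + (sqrt (1 - t))\<^sup>2 / (q - b)) * ((p - b) * E + (q - b) * E')"
        unfolding E_def E'_def using b by (intro weighted_Cauchy_Schwarz) auto
      finally show ?thesis
        using t by simp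
    qed
    then have "(a - b) * V \<le> (a - b) * ((t / (p - b) + (1 - t) / (q - b)) * ((p - b) * E + (q - b) * E'))"
      using b by (intro mult_left_mono) auto
    also have "\<dots> = ((a - b) * (t / (p - b) + (1 - t) / (q - b))) * ((p - b) * E + (q - b) * E')"
      by (simp only: mult.assoc)
    also have "\<dots> \<le> 1 * ((p - b) * E + (q - b) * E')"
      using le b by (intro mult_right_mono) (auto simp: E_def E'_def)
    finally have "(a - b) * V \<le> (p - b) * E + (q - b) * E'"
      by simp
    moreover have "(q - b) * E' \<le> (q - b) * (n - E)"
      using E'_le b by (intro mult_left_mono) auto
    ultimately have "a * V + b * (n - V) \<le> p * E + q * (n - E)"
      by (simp add: algebra_simps)
    then show "0 \<le> inner ((Y - X) x) x"
      by (simp add: X_def Y_def blinfun.diff_left inner_diff_left inner_two_point_op inner_vector_proj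
          V_def E_def n_def)
  qed
  then have "X \<le>\<^sub>o\<^sub>p Y"
    by (simp add: op_le_def)
  moreover have "complex_of_real ` {b..M} \<subseteq> complex_of_real ` {0<..}"
    using b(1) by (intro image_mono) auto
  then have "spectrum_op X \<subseteq> complex_of_real ` {0<..}" "spectrum_op Y \<subseteq> complex_of_real ` {0<..}"
    using spectrum_op_subset[OF X.between] spectrum_op_subset[OF Y.between] by (blast intro: subset_trans)+
  ultimately have "cfc f X \<le>\<^sub>o\<^sub>p cfc f Y"
    using mono X.hermitian Y.hermitian by (simp add: operator_monotone_on_def hermitian_op_selfadjoint)
  then have ineq: "inner (cfc f X x) x \<le> inner (cfc f Y x) x" for x
    by (simp add: op_le_def positive_op_iff blinfun.diff_left inner_diff_left)
  have fX: "inner (cfc f X x) x = f a * (cmod (cinner x v))\<^sup>2 + f b * ((norm x)\<^sup>2 - (cmod (cinner x v))\<^sup>2)" for x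
    unfolding X_def using cfc_two_point_op[OF proj(1) proj(2)[OF v] M(1,2,3) cont]
    by (simp add: inner_two_point_op inner_vector_proj)
  have fY: "inner (cfc f Y x) x = f p * (cmod (cinner x e))\<^sup>2 + f q * ((norm x)\<^sup>2 - (cmod (cinner x e))\<^sup>2)" for x
    unfolding Y_def using cfc_two_point_op[OF proj(1) proj(2)[OF e(1)] M(1,4,5) cont]
    by (simp add: inner_two_point_op inner_vector_proj)
  have ve: "(cmod (cinner v e))\<^sup>2 = t"
    using cinner_commute[of v e] ev t by simp
  show "t * f a + (1 - t) * f b \<le> f p"
    using ineq[of e] t by (simp add: fX fY ev e cinner_self mult.commute)
  show "f a \<le> t * f p + (1 - t) * f q"
    using ineq[of v] t by (simp add: fX fY ve v vv mult.commute)
qed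

lemma infinite_dimensional_orthonormal_pair:
  assumes "infinite_dimensional TYPE('k::complex_hilbert)"
  obtains e e' :: "'k::complex_hilbert" where "norm e = 1" "norm e' = 1" "cinner e e' = 0"
proof -
  have span: "\<exists>x. x \<notin> span B" if "finite B" for B :: "'k::complex_hilbert set"
    using assms that by (auto simp: infinite_dimensional_def)
  obtain x :: "'k::complex_hilbert" where "x \<notin> span {}"
    using span[of "{}"] by blast
  then have x: "x \<noteq> 0"
    by simp
  define e where "e = (1 / norm x) *\<^sub>R x"
  have e: "norm e = 1"
    using x by (simp add: e_def)
  \<comment> \<open>\<open>span\<close> is the real span; avoiding the span of e and i e means
    avoiding the complex line through e.\<close>
  obtain y where y: "y \<notin> span {e, \<i> *\<^sub>C e}"
    using span[of "{e, \<i> *\<^sub>C e}"] by blast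
  define z where "z = y - cinner y e *\<^sub>C e"
  have "cinner y e *\<^sub>C e \<in> span {e, \<i> *\<^sub>C e}"
    unfolding scaleC_decomp[of "cinner y e"] by (intro span_add span_scale span_base) auto
  then have z: "z \<noteq> 0"
    using y by (auto simp: z_def)
  define e' where "e' = (1 / norm z) *\<^sub>R z"
  have "cinner z e = 0"
    by (simp add: z_def cinner_diff_left cinner_scaleC_left cinner_self e)
  then have "cinner e z = 0"
    by (metis cinner_commute complex_cnj_zero)
  then have "cinner e e' = 0"
    by (simp add: e'_def cinner_scaleR_right)
  moreover have "norm e' = 1"
    using z by (simp add: e'_def)
  ultimately show ?thesis
    using that e by blast
qed

section \<open>Monotonicity, concavity and strict monotonicity of f\<close>

context
  fixes f :: "real \<Rightarrow> real"
  assumes inf_dim: "infinite_dimensional TYPE('k::complex_hilbert)"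
    and monotone: "operator_monotone_on TYPE('k::complex_hilbert) {0<..} f"
begin

lemma operator_monotone_eigenvalues:
  assumes "0 < b" "b < p" "b < q" "b \<le> a" "0 \<le> t" "t \<le> 1"
    and "(a - b) * (t / (p - b) + (1 - t) / (q - b)) \<le> 1"
  shows "t * f a + (1 - t) * f b \<le> f p" and "f a \<le> t * f p + (1 - t) * f q"
proof -
  obtain e e' :: "'k::complex_hilbert" where "norm e = 1" "norm e' = 1" "cinner e e' = 0"
    using infinite_dimensional_orthonormal_pair[OF inf_dim] .
  from operator_monotone_two_point[OF monotone this assms]
  show "t * f a + (1 - t) * f b \<le> f p" "f a \<le> t * f p + (1 - t) * f q"
    by blast+
qed

lemma operator_monotone_imp_mono:
  assumes "0 < x" "x \<le> y"
  shows "f x \<le> f y"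
  \<comment> \<open>The case t = 1, where v = e; the common eigenvalue b = x / 2 is an arbitrary
    positive value below x.\<close>
  using operator_monotone_eigenvalues(2)[of "x / 2" y y x 1] assms by (simp add: field_simps)

text \<open>X gets the eigenvalues y and x, and its diagonal entry at e is their mean p0. For any p
  above p0 a large q makes X <= Y hold, and f q does not enter the first eigenvalue inequality;
  continuity then brings p down to p0.\<close>

lemma operator_monotone_imp_concave: "concave_on {0<..} f"
proof
  fix t x y :: real
  assume t: "0 < t" "t < 1" and xy: "x \<in> {0<..}" "y \<in> {0<..}" "x < y"
  define p0 where "p0 = (1 - t) * x + t * y"
  have p0: "p0 = x + t * (y - x)"
    by (simp add: p0_def algebra_simps)
  have above: "t * f y + (1 - t) * f x \<le> f p" if "p > p0" for p
  proof -
    \<comment> \<open>The slack that the p term leaves in the comparison condition; q is taken so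
      large that its term fits into r.\<close>
    define r where "r = 1 - (y - x) * (t / (p - x))"
    have px: "p - x > t * (y - x)" "t * (y - x) > 0"
      using that xy t by (simp_all add: p0)
    then have r: "r > 0"
      by (simp add: r_def field_simps)
    define q where "q = x + (y - x) / r"
    have "(y - x) * ((1 - t) / (q - x)) = (1 - t) * r"
      using r xy by (simp add: q_def)
    also have "\<dots> \<le> 1 * r"
      using t r by (intro mult_right_mono) auto
    finally have "(y - x) * (t / (p - x) + (1 - t) / (q - x)) \<le> 1"
      by (simp add: r_def distrib_left)
    moreover have "x < q"
      using r xy by (simp add: q_def)
    ultimately show ?thesis
      using operator_monotone_eigenvalues(1)[of x p q y t] px xy t by simp
  qed
  have "p0 > 0"
    using xy t by (simp add: p0 add_pos_pos)
  moreover have "continuous_on {0<..} f"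
    using monotone by (simp add: operator_monotone_on_def)
  ultimately have "isCont f p0"
    by (simp add: continuous_on_eq_continuous_at)
  then have "(f \<longlongrightarrow> f p0) (at_right p0)"
    by (simp add: isCont_def filterlim_at_split)
  then have "t * f y + (1 - t) * f x \<le> f p0"
    by (rule tendsto_lowerbound) (auto simp: eventually_at_right_field intro: above exI[of _ "p0 + 1"])
  then show "(1 - t) * f x + t * f y \<le> f ((1 - t) *\<^sub>R x + t *\<^sub>R y)"
    by (simp add: p0_def add.commute)
qed simp

text \<open>Monotonicity and concavity alone allow a function like min x 1. If f x = f y, they give
  f <= f x everywhere; a smaller value to the left of x is then excluded by the second eigenvalue
  inequality, where any weight t > 0 on f p forces f x <= f p.\<close>

lemma operator_monotone_imp_strict_mono:
  assumes nonconst: "\<not> f constant_on {0<..}" and "0 < x" "x < y"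
  shows "f x < f y"
proof (rule ccontr)
  assume "\<not> f x < f y"
  then have eq: "f y = f x"
    using operator_monotone_imp_mono[of x y] assms by simp
  have upper: "f s \<le> f x" if "s > 0" for s
  proof (cases "s \<le> y")
    case True
    then show ?thesis
      using operator_monotone_imp_mono[OF that True] eq by simp
  next
    case False
    then show ?thesis
      using concave_on_forward_difference[OF operator_monotone_imp_concave, of x "y - x" s] assms that eq
      by simp
  qed
  have lower: "f x \<le> f p" if "p > 0" for p
  proof (cases "x \<le> p")
    case True
    then show ?thesis
      using operator_monotone_imp_mono assms by simp
  next
    case False
    define b where "b = p / 2"
    define q where "q = x + 1"
    have b: "0 < b" "b < p" "b < x" "b < q"
      using that False by (simp_all add: b_def q_def)
    \<comment> \<open>The slack left by the q term even at full weight; t is then chosen small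
      enough for the p term to fit into it.\<close>
    define r where "r = 1 - (x - b) * (1 / (q - b))"
    have r: "r > 0"
      using b by (simp add: r_def q_def)
    define t where "t = min 1 (r * (p - b) / (x - b))"
    have t: "0 < t" "t \<le> 1"
      using r b by (simp_all add: t_def)
    have "(x - b) * (t / (p - b)) \<le> (x - b) * ((r * (p - b) / (x - b)) / (p - b))"
      using b by (intro mult_left_mono divide_right_mono) (simp_all add: t_def)
    also have "\<dots> = r"
      using b by simp
    finally have "(x - b) * (t / (p - b)) \<le> r" .
    moreover have "(x - b) * ((1 - t) / (q - b)) \<le> (x - b) * (1 / (q - b))"
      using b t by (intro mult_left_mono divide_right_mono) simp_all
    ultimately have "(x - b) * (t / (p - b) + (1 - t) / (q - b)) \<le> 1"
      unfolding distrib_left r_def by linarith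
    then have "f x \<le> t * f p + (1 - t) * f q"
      using operator_monotone_eigenvalues(2)[of b p q x t] b t by simp
    also have "\<dots> \<le> t * f p + (1 - t) * f x"
      using upper[of q] t assms by (intro add_left_mono mult_left_mono) (simp_all add: q_def)
    finally have "t * f x \<le> t * f p"
      by (simp add: algebra_simps)
    then show ?thesis
      using t by simp
  qed
  have "f p = f x" if "p \<in> {0<..}" for p
    using upper[of p] lower[of p] that by simp
  then show False
    using nonconst by (auto simp: constant_on_def)
qed

end

text \<open>On this interval the second derivative -1 / y^2 of \<open>ln\<close> is at most -1 /
  K^2, which the second derivative 1 / K^2 of the added term just compensates.\<close>

lemma concave_on_ln_plus_square:
  assumes "K > 0"
  shows "concave_on {0<..K} (\<lambda>y. ln y + 1 / (2 * K\<^sup>2) * y\<^sup>2)"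
proof (rule f''_le0_imp_concave)
  fix y :: real
  assume y: "y \<in> {0<..K}"
  show "((\<lambda>y. ln y + 1 / (2 * K\<^sup>2) * y\<^sup>2) has_real_derivative (1 / y + y / K\<^sup>2)) (at y)"
    using y assms by (auto intro!: derivative_eq_intros simp: field_simps)
  show "((\<lambda>y. 1 / y + y / K\<^sup>2) has_real_derivative (- (1 / y\<^sup>2) + 1 / K\<^sup>2)) (at y)"
    using y assms by (auto intro!: derivative_eq_intros simp: field_simps power2_eq_square)
  have "1 / K\<^sup>2 \<le> 1 / y\<^sup>2"
    using y by (intro divide_left_mono power_mono mult_pos_pos) auto
  then show "- (1 / y\<^sup>2) + 1 / K\<^sup>2 \<le> 0"
    by simp
qed simp

text \<open>The Jensen defect of the square: a function stays concave after adding c t^2 exactly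
  when its own concavity defect dominates c times this quantity.\<close>

lemma square_convex_combination:
  fixes x y t :: real
  shows "(1 - t) * x\<^sup>2 + t * y\<^sup>2 - ((1 - t) * x + t * y)\<^sup>2 = t * (1 - t) * (y - x)\<^sup>2"
  by (simp add: power2_eq_square algebra_simps)

text \<open>
  On a compact interval \<open>ln\<close> is strongly concave, and the slopes of \<open>f\<close> are bounded away from \<open>0\<close>; so
  \<open>ln \<circ> f\<close> is strongly concave too.
\<close>

lemma ln_concave_comp_strongly_concave:
  assumes concave: "concave_on {0<..} f" and strict: "\<And>x y. 0 < x \<Longrightarrow> x < y \<Longrightarrow> f x < f y"
    and pos: "\<And>x. 0 < x \<Longrightarrow> 0 < f x" and m: "0 < m" "m < M"
  obtains c where "c > 0" "concave_on {m..M} (\<lambda>t. ln (f t) + c * t\<^sup>2)"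
proof -
  define K where "K = f M"
  \<comment> \<open>By concavity a slope of f inside [m, M] is at least the secant slope from its
    right end y to M + 1; there the rise is at least f (M + 1) - f M and the run at most M + 1 -
    m.\<close>
  define \<kappa> where "\<kappa> = (f (M + 1) - f M) / (M + 1 - m)"
  define a where "a = 1 / (2 * K\<^sup>2)"
  have K: "K > 0"
    using pos m by (simp add: K_def)
  have \<kappa>: "\<kappa> > 0"
    using strict[of M "M + 1"] m by (simp add: \<kappa>_def)
  have a: "a > 0"
    using K by (simp add: a_def)
  have mono: "f x \<le> f y" if "0 < x" "x \<le> y" for x y
    using strict[of x y] that by (cases "x = y") auto
  have slope: "\<kappa> * (y - x) \<le> f y - f x" if "x \<in> {m..M}" "y \<in> {m..M}" "x \<le> y" for x y
  proof -
    define Q where "Q = (f (M + 1) - f y) / (M + 1 - y)"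
    have "f x \<le> f y + (x - y) * Q"
      using concave_on_forward_difference[OF concave, of y "M + 1 - y" x] that m by (simp add: Q_def)
    then have "(y - x) * Q \<le> f y - f x"
      by (simp add: left_diff_distrib)
    moreover have "\<kappa> \<le> Q"
      unfolding Q_def \<kappa>_def using that m mono[of y M] mono[of M "M + 1"] by (intro frac_le) auto
    then have "(y - x) * \<kappa> \<le> (y - x) * Q"
      using that by (intro mult_left_mono) auto
    ultimately show ?thesis
      by (simp add: mult.commute)
  qed
  have "concave_on {m..M} (\<lambda>t. ln (f t) + a * \<kappa>\<^sup>2 * t\<^sup>2)"
  proof
    fix t x y :: real
    assume t: "0 < t" "t < 1" and xy: "x \<in> {m..M}" "y \<in> {m..M}" "x < y"
    define z where "z = (1 - t) * x + t * y"
    define w where "w = (1 - t) * f x + t * f y"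
    have fx: "f x \<in> {0<..K}" "f y \<in> {0<..K}"
      using pos[of x] pos[of y] mono[of x M] mono[of y M] xy m by (auto simp: K_def)
    have w: "w > 0"
      using fx t by (simp add: w_def add_pos_pos)
    have "w \<le> f z"
      using concave_onD[OF concave, of t x y] t xy m by (simp add: w_def z_def)
    then have "ln w \<le> ln (f z)"
      using w by simp
    moreover have "(1 - t) * (ln (f x) + a * (f x)\<^sup>2) + t * (ln (f y) + a * (f y)\<^sup>2) \<le> ln w + a * w\<^sup>2"
      using concave_onD[OF concave_on_ln_plus_square[OF K] _ _ fx, of t] t by (simp add: w_def a_def)
    then have "(1 - t) * ln (f x) + t * ln (f y) + a * ((1 - t) * (f x)\<^sup>2 + t * (f y)\<^sup>2 - w\<^sup>2) \<le> ln w"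
      by (simp add: algebra_simps)
    then have "(1 - t) * ln (f x) + t * ln (f y) + a * (t * (1 - t) * (f y - f x)\<^sup>2) \<le> ln w"
      unfolding w_def square_convex_combination .
    moreover have "a * (t * (1 - t) * (\<kappa> * (y - x))\<^sup>2) \<le> a * (t * (1 - t) * (f y - f x)\<^sup>2)"
      using slope[of x y] xy \<kappa> t a by (intro mult_left_mono power_mono) auto
    moreover have "a * (t * (1 - t) * (\<kappa> * (y - x))\<^sup>2) = a * \<kappa>\<^sup>2 * ((1 - t) * x\<^sup>2 + t * y\<^sup>2 - z\<^sup>2)"
      unfolding z_def square_convex_combination by (simp add: power_mult_distrib)
    ultimately have "(1 - t) * ln (f x) + t * ln (f y) + a * \<kappa>\<^sup>2 * ((1 - t) * x\<^sup>2 + t * y\<^sup>2 - z\<^sup>2) \<le> ln (f z)"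
      by linarith
    then show "(1 - t) * (ln (f x) + a * \<kappa>\<^sup>2 * x\<^sup>2) + t * (ln (f y) + a * \<kappa>\<^sup>2 * y\<^sup>2)
        \<le> ln (f ((1 - t) *\<^sub>R x + t *\<^sub>R y)) + a * \<kappa>\<^sup>2 * ((1 - t) *\<^sub>R x + t *\<^sub>R y)\<^sup>2"
      by (simp add: z_def algebra_simps)
  qed simp
  then show ?thesis
    by (rule that[rotated]) (use a \<kappa> in simp)
qed

section \<open>The determinant inequality\<close>

text \<open>From 0 <= A <= N follows A^2 <= N A, so the bound |A x| >= c |x| that regularity
  provides becomes a lower bound c^2 / N for the quadratic form.\<close>

lemma regular_positive_between:
  assumes "positive_op A" "regular_op A"
  obtains m M where "0 < m" "m < M" "op_between m M A"
proof -
  define N where "N = norm A + 1"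
  have N: "N > 0"
    by (simp add: N_def add_nonneg_pos)
  have A: "hermitian_op A" "\<And>x. 0 \<le> inner (A x) x"
    using assms(1) by (auto simp: positive_op_iff)
  have upper: "inner (A x) x \<le> N * (norm x)\<^sup>2" for x
    using abs_inner_blinfun_le[of A x] by (simp add: N_def distrib_right add_increasing2)
  interpret op_interval 0 N A
    using N A upper by unfold_locales (simp_all add: op_between_def)
  have "positive_op (cfc (\<lambda>s. N * s - s * s) A)"
    by (rule cfc_nonneg) (auto intro!: continuous_intros mult_right_mono)
  also have "cfc (\<lambda>s. N * s - s * s) A = N *\<^sub>R A - (A o\<^sub>L A)"
    by (simp add: cfc_diff cfc_cmult cfc_mult cfc_ident continuous_intros)
  finally have nonneg: "0 \<le> inner ((N *\<^sub>R A - (A o\<^sub>L A)) x) x" for x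
    by (simp add: positive_op_iff)
  have square: "(norm (A x))\<^sup>2 \<le> N * inner (A x) x" for x
    using nonneg[of x] hermitian_op_inner[OF A(1), of "A x" x]
    by (simp add: blinfun.bilinear_simps inner_diff_left power2_norm_eq_inner)
  obtain c where c: "c > 0" "\<And>x. c * norm x \<le> norm (A x)"
    using regular_imp_bounded_below[OF assms(2)] by (auto simp: bounded_below_def)
  define m where "m = c\<^sup>2 / N"
  have lower: "m * (norm x)\<^sup>2 \<le> inner (A x) x" for x
  proof -
    have "(c * norm x)\<^sup>2 \<le> N * inner (A x) x"
      by (rule order_trans[OF power_mono[OF c(2)] square]) (use c(1) in simp)
    then show ?thesis
      using N by (simp add: m_def power_mult_distrib field_simps)
  qed
  show ?thesis
  proof
    \<comment> \<open>On the zero space nothing bounds c, so m < N may fail; the upper end m + N is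
      safe.\<close>
    show "0 < m" "m < m + N"
      using c N by (simp_all add: m_def)
    moreover have "op_between m N A"
      using lower A upper by (simp add: op_between_def)
    ultimately show "op_between m (m + N) A"
      using op_between_mono[of m N A m "m + N"] by simp
  qed
qed

theorem theorem4p9:
  fixes R S :: "('h::complex_hilbert \<Rightarrow>\<^sub>L 'h) set"
    and \<tau> :: "('h \<Rightarrow>\<^sub>L 'h) \<Rightarrow> complex"
    and \<Phi> :: "('h \<Rightarrow>\<^sub>L 'h) \<Rightarrow> 'h \<Rightarrow>\<^sub>L 'h"
    and f :: "real \<Rightarrow> real"
    and A :: "'h \<Rightarrow>\<^sub>L 'h"
  assumes "separable_space (euclidean :: 'h topology)"
    and "finite_von_neumann_algebra R"
    and "faithful_normal_tracial_state R \<tau>"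
    and "von_neumann_algebra S" and "S \<subseteq> R"
    and "conditional_expectation R S \<Phi>" and "\<Phi> ` R = S"
    and "\<forall>X\<in>R. \<tau> (\<Phi> X) = \<tau> X"
    and "\<forall>t>0. f t > 0"
    and "\<not> f constant_on {0<..}"
    and "infinite_dimensional TYPE('k::complex_hilbert)"
    and "operator_monotone_on TYPE('k) {0<..} f"
    and "A \<in> R" and "positive_op A" and "regular_op A"
  shows "FK_det \<tau> (cfc f A) \<le> FK_det \<tau> (cfc f (\<Phi> A))
    \<and> (FK_det \<tau> (cfc f A) = FK_det \<tau> (cfc f (\<Phi> A)) \<longleftrightarrow> \<Phi> A = A)
    \<and> (\<Phi> A = A \<longleftrightarrow> A \<in> S)"
proof -
  interpret trace_preserving_expectation R S \<tau> \<Phi>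
    using assms(2-6,8)
    by unfold_locales (auto simp: finite_von_neumann_algebra_def faithful_normal_tracial_state_def)
  note A = \<open>A \<in> R\<close>
  obtain m M where mM: "0 < m" "m < M" and between: "op_between m M A"
    using regular_positive_between[OF assms(14,15)] .
  interpret A: op_interval m M A
    using mM between by unfold_locales
  interpret B: op_interval m M "\<Phi> A"
    using mM expectation_between[OF A between] by unfold_locales
  have f_cont: "continuous_on {0<..} f"
    using assms(12) by (simp add: operator_monotone_on_def)
  have cont: "continuous_on {m..M} f"
    by (rule continuous_on_subset[OF f_cont]) (use mM in auto)
  \<comment> \<open>The extra unit on the right is the room for the forward differences in
    \<open>trace_Jensen\<close>.\<close>
  have ln_cont: "continuous_on {m..M + 1} (\<lambda>t. ln (f t))"
  proof (intro continuous_on_ln continuous_on_subset[OF f_cont] ballI)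
    show "f t \<noteq> 0" if "t \<in> {m..M + 1}" for t
      using that mM assms(9) by (metis atLeastAtMost_iff less_irrefl less_le_trans)
  qed (use mM in auto)
  have f_pos: "f t > 0" if "t \<in> {m..M}" for t
    using that mM assms(9) by simp
  have det: "FK_det \<tau> (cfc f A) = exp (tr (cfc (\<lambda>t. ln (f t)) A))"
    "FK_det \<tau> (cfc f (\<Phi> A)) = exp (tr (cfc (\<lambda>t. ln (f t)) (\<Phi> A)))"
    using A.FK_det_cfc[OF cont f_pos] B.FK_det_cfc[OF cont f_pos] by blast+
  obtain c where c: "c > 0" "concave_on {m..M + 1} (\<lambda>t. ln (f t) + c * t\<^sup>2)"
  proof (rule ln_concave_comp_strongly_concave)
    show "concave_on {0<..} f"
      by (rule operator_monotone_imp_concave[OF assms(11,12)])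
    show "f x < f y" if "0 < x" "x < y" for x y
      by (rule operator_monotone_imp_strict_mono[OF assms(11,12,10) that])
    show "0 < m" "m < M + 1"
      using mM by auto
  qed (use assms(9) in auto)
  define D where "D = A - \<Phi> A"
  have D: "D \<in> R" "hermitian_op D"
    using expectation_in[OF A] S_sub_R vN_diff[OF R A] hermitian_op_diff[OF A.hermitian B.hermitian]
    by (auto simp: D_def)
  have main: "tr (cfc (\<lambda>t. ln (f t)) A) + c * tr (D o\<^sub>L D) \<le> tr (cfc (\<lambda>t. ln (f t)) (\<Phi> A))"
    unfolding D_def by (rule trace_Jensen_strong[OF A mM(2) between ln_cont c(2)])
  have D_nonneg: "0 \<le> tr (D o\<^sub>L D)"
    using D by (intro tr_nonneg vN_compose[OF R] positive_op_square)
  have "\<Phi> A = A" if "FK_det \<tau> (cfc f A) = FK_det \<tau> (cfc f (\<Phi> A))"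
  proof -
    have "c * tr (D o\<^sub>L D) \<le> 0"
      using main that by (simp add: det)
    then have "tr (D o\<^sub>L D) = 0"
      using D_nonneg c(1) by (simp add: mult_le_0_iff)
    then have "D = 0"
      by (rule tr_square_eq_0[OF D])
    then show ?thesis
      by (simp add: D_def)
  qed
  moreover have "FK_det \<tau> (cfc f A) \<le> FK_det \<tau> (cfc f (\<Phi> A))"
    using main mult_nonneg_nonneg[OF less_imp_le[OF c(1)] D_nonneg] by (simp add: det)
  moreover have "\<Phi> A = A \<longleftrightarrow> A \<in> S"
    using expectation_in[OF A] expectation_on_S[of A] by auto
  ultimately show ?thesis
    by auto
qed

end
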